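(* Let $R$ be a commutative unital ring. For every integer $n\geq 2$, the standard identity of degree $4n-2$ is a polynomial identity of both $M_nE^2$ and $M_nE^3$.
   Context: $E^m=R\langle v_1,\dots,v_m\rangle/(v_i^2,\ v_iv_j+v_jv_i \mid 1\le i,j\le m)$ is the $m$-generated Grassmann algebra over $R$, and $M_nE^m$ is the ring of $n\times n$ matrices over $E^m$. The standard polynomial of degree $k$ is $s_k(x_1,\dots,x_k)=\sum_{\pi\in\mathfrak{S}_k}\mathrm{sgn}(\pi)x_{\pi(1)}\cdots x_{\pi(k)}$; it is a polynomial identity if it vanishes for all substitutions of elements of the algebra. *)

theory Defs
  imports "HOL-Combinatorics.Permutations"
begin

text \<open>Grassmann algebra E^m over a commutative unital ring 'a, realised on its
  standard basis: an element is a coefficient function on finite sets of generator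
  indices; the set A = {a1 < ... < ak} stands for the monomial v_a1 ... v_ak.
  E^m consists of the functions supported on subsets of {0..<m} (generators v_0..v_(m-1)).\<close>

type_synonym 'a grass = "nat set \<Rightarrow> 'a"

definition grass_carrier :: "nat \<Rightarrow> 'a::comm_ring_1 grass set" where
  "grass_carrier m = {x. \<forall>S. \<not> S \<subseteq> {0..<m} \<longrightarrow> x S = 0}"

text \<open>Sign of reordering e_A e_B into e_(A \<union> B) (A, B disjoint): number of inversions.\<close>
definition gsign :: "nat set \<Rightarrow> nat set \<Rightarrow> 'a::comm_ring_1" where
  "gsign A B = (-1) ^ card {(a, b). a \<in> A \<and> b \<in> B \<and> b < a}"

definition gmult :: "'a::comm_ring_1 grass \<Rightarrow> 'a grass \<Rightarrow> 'a grass" where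
  "gmult x y = (\<lambda>S. \<Sum>A\<in>Pow S. gsign A (S - A) * x A * y (S - A))"

definition gone :: "'a::comm_ring_1 grass" where
  "gone = (\<lambda>S. if S = {} then 1 else 0)"

text \<open>n x n matrices over the Grassmann algebra (entries indexed by i, j < n).\<close>
type_synonym 'a gmat = "nat \<Rightarrow> nat \<Rightarrow> 'a grass"

definition gmat_mult :: "nat \<Rightarrow> 'a::comm_ring_1 gmat \<Rightarrow> 'a gmat \<Rightarrow> 'a gmat" where
  "gmat_mult n A B = (\<lambda>i j S. \<Sum>k<n. gmult (A i k) (B k j) S)"

definition gmat_one :: "nat \<Rightarrow> 'a::comm_ring_1 gmat" where
  "gmat_one n = (\<lambda>i j. if i = j then gone else (\<lambda>_. 0))"

fun gmat_prod :: "nat \<Rightarrow> 'a::comm_ring_1 gmat list \<Rightarrow> 'a gmat" where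
  "gmat_prod n [] = gmat_one n"
| "gmat_prod n (A # As) = gmat_mult n A (gmat_prod n As)"

definition std_poly :: "nat \<Rightarrow> nat \<Rightarrow> (nat \<Rightarrow> 'a::comm_ring_1 gmat) \<Rightarrow> 'a gmat" where
  "std_poly n k x = (\<lambda>i j S. \<Sum>p\<in>{p. p permutes {0..<k}}.
      of_int (sign p) * gmat_prod n (map (\<lambda>t. x (p t)) [0..<k]) i j S)"

definition std_identity_of :: "'a::comm_ring_1 itself \<Rightarrow> nat \<Rightarrow> nat \<Rightarrow> nat \<Rightarrow> bool" where
  "std_identity_of _ n m k \<longleftrightarrow>
     (\<forall>x :: nat \<Rightarrow> 'a gmat.
        (\<forall>t<k. \<forall>i<n. \<forall>j<n. x t i j \<in> grass_carrier m) \<longrightarrow>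
        (\<forall>i<n. \<forall>j<n. \<forall>S. std_poly n k x i j S = 0))"

end

theory Submission
  imports Defs "Jordan_Normal_Form.Determinant" "HOL-Computational_Algebra.Formal_Power_Series"
    "HOL-Combinatorics.Multiset_Permutations"
begin

no_notation vec_index (infixl \<open>$\<close> 100)
unbundle fps_syntax

text \<open>
  Let \<open>k = 4n - 2\<close>. By multilinearity the arguments may be taken of the form \<open>a\<^sub>t v\<^bsub>U(t)\<^esub>\<close> with integer
  matrices \<open>a\<^sub>t\<close>, so everything happens in characteristic 0 and it remains to show that
  \<open>\<Sum>\<^sub>\<pi> sgn \<pi> \<cdot> sgn (\<pi> restricted to Q) \<cdot> a\<^bsub>\<pi>(1)\<^esub> \<cdots> a\<^bsub>\<pi>(k)\<^esub> = 0\<close>, where \<open>Q\<close> is the set of the arguments of odd degree;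
  it has at most three elements. Multiply by an arbitrary matrix and take the trace. Since \<open>k + 1\<close> and 3
  are odd, the result is invariant under cyclic rotations, so that one may put one of three
  distinguished letters \<open>A, B, C\<close> last, both for \<open>|Q| = 2\<close> (the extra matrix being the third letter) and for
  \<open>|Q| = 3\<close>. The cases \<open>|Q| \<le> 1\<close> are the theorem of Amitsur and Levitzki.

  Following Rosset, let \<open>X = \<Sum> e\<^sub>t a\<^sub>t\<close> with anticommuting \<open>e\<^sub>t\<close>. The square \<open>T = X\<^sup>2\<close> has entries in a commutative
  ring and \<open>tr T\<^sup>m = 0\<close> for \<open>m > 0\<close>; consequently the \<open>p\<close>-minors of \<open>G = \<Sum> u\<^sup>m T\<^sup>m\<close> have degree at most
  \<open>n - p\<close> in \<open>u\<close>. The case \<open>p = 1\<close> is the Amitsur-Levitzki theorem. The cases \<open>p = 2, 3\<close>, contracted with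
  \<open>A, B, C\<close>, express the generating function of the required sum through products of the traces \<open>tr (G A)\<close>,
  \<open>tr (G B)\<close>, \<open>tr (G C)\<close> and terms of degree less than \<open>2n - 2\<close> in \<open>u\<close>; any two of these traces have a
  product of degree less than \<open>n\<close>, and this forces the coefficient of \<open>u\<^bsup>2n-2\<^esup>\<close> in the triple product to vanish
  if \<open>n \<ge> 2\<close>.
\<close>

section \<open>Derivatives of determinants\<close>

lemma fps_deriv_prod:
  fixes f :: "'i \<Rightarrow> 'b::comm_ring_1 fps"
  assumes "finite I"
  shows "fps_deriv (\<Prod>i\<in>I. f i) = (\<Sum>i\<in>I. \<Prod>j\<in>I. if j = i then fps_deriv (f j) else f j)"
  using assms
proof (induction I rule: finite_induct)
  case (insert x I)
  have 1: "(\<Prod>j\<in>I. if j = x then fps_deriv (f j) else f j) = (\<Prod>j\<in>I. f j)"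
    by (rule prod.cong) (use insert in auto)
  have 2: "(\<Prod>j\<in>insert x I. if j = i then fps_deriv (f j) else f j)
      = f x * (\<Prod>j\<in>I. if j = i then fps_deriv (f j) else f j)" if "i \<in> I" for i
    using insert that by (subst prod.insert) auto
  show ?case
    using insert 1 2 by (simp add: sum_distrib_left add.commute)
qed auto

text \<open>Jacobi's formula. The product rule differentiates one row at a time; expansion along
  that row leaves cofactors of \<open>M\<close>, since deleting the row removes the only
  difference.\<close>

lemma fps_deriv_det:
  fixes M :: "'b::comm_ring_1 fps mat"
  assumes M: "M \<in> carrier_mat p p"
  shows "fps_deriv (det M) = (\<Sum>i<p. \<Sum>j<p. fps_deriv (M $$ (i,j)) * cofactor M i j)"
proof -
  define M' where "M' i = mat p p (\<lambda>(r,c). if r = i then fps_deriv (M $$ (r,c)) else M $$ (r,c))" for i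
  have M'c: "M' i \<in> carrier_mat p p" for i by (simp add: M'_def)
  have s: "fps_deriv (signof q * x) = signof q * fps_deriv x" for q and x :: "'b fps"
    by (simp add: sign_def)
  have "fps_deriv (det M) = (\<Sum>q | q permutes {0..<p}. signof q * fps_deriv (\<Prod>i=0..<p. M $$ (i, q i)))"
    using M by (simp add: det_def fps_deriv_sum s)
  also have "\<dots> = (\<Sum>q | q permutes {0..<p}. signof q * (\<Sum>i=0..<p. \<Prod>j=0..<p. M' i $$ (j, q j)))"
  proof (rule sum.cong[OF refl], goal_cases)
    case (1 q)
    then have q: "q permutes {0..<p}" by simp
    have "(\<Sum>i=0..<p. \<Prod>j=0..<p. if j = i then fps_deriv (M $$ (j, q j)) else M $$ (j, q j))
      = (\<Sum>i=0..<p. \<Prod>j=0..<p. M' i $$ (j, q j))"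
      by (intro sum.cong prod.cong refl) (use permutes_in_image[OF q] in \<open>auto simp: M'_def\<close>)
    then show ?case by (simp add: fps_deriv_prod)
  qed
  also have "\<dots> = (\<Sum>i=0..<p. \<Sum>q | q permutes {0..<p}. signof q * (\<Prod>j=0..<p. M' i $$ (j, q j)))"
    by (simp add: sum_distrib_left sum.swap[of _ "{0..<p}"])
  also have "\<dots> = (\<Sum>i<p. det (M' i))"
    by (simp add: det_def M'_def lessThan_atLeast0)
  also have "\<dots> = (\<Sum>i<p. \<Sum>j<p. M' i $$ (i,j) * cofactor (M' i) i j)"
    by (intro sum.cong refl laplace_expansion_row[OF M'c]) auto
  also have "\<dots> = (\<Sum>i<p. \<Sum>j<p. fps_deriv (M $$ (i,j)) * cofactor M i j)"
  proof (intro sum.cong refl, goal_cases)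
    case (1 i j)
    have "mat_delete (M' i) i j = mat_delete M i j"
      by (rule eq_matI) (use M 1 in \<open>auto simp: mat_delete_def M'_def\<close>)
    then show ?case using 1 by (simp add: cofactor_def M'_def)
  qed
  finally show ?thesis .
qed

text \<open>Expanding along the border column and then the border row leaves the value w det M - z
  adj(M) y. The border later supplies the extra row and column by which a minor of size p + 1
  exceeds one of size p.\<close>

lemma det_bordered:
  fixes M :: "'b::comm_ring_1 mat"
  assumes M: "M \<in> carrier_mat p p"
  shows "det (mat (Suc p) (Suc p) (\<lambda>(i,j). if i < p then (if j < p then M $$ (i,j) else y i)
            else (if j < p then z j else w)))
     = w * det M - (\<Sum>i<p. \<Sum>j<p. y i * z j * cofactor M i j)" (is "det ?N = _")
proof -
  have N: "?N \<in> carrier_mat (Suc p) (Suc p)" by simp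
  have d: "det ?N = (\<Sum>i<Suc p. ?N $$ (i,p) * cofactor ?N i p)"
    by (rule laplace_expansion_column[OF N]) simp
  have pp: "mat_delete ?N p p = M"
    by (rule eq_matI) (use M in \<open>auto simp: mat_delete_def\<close>)
  have c: "cofactor ?N i p = - (\<Sum>j<p. z j * cofactor M i j)" if i: "i < p" for i
  proof -
    let ?D = "mat_delete ?N i p"
    have D: "?D \<in> carrier_mat p p" by (auto simp: mat_delete_def)
    \<comment> \<open>Row \<open>i\<close> is gone, so the border row now has index p - 1; this
      shift produces the minus sign.\<close>
    have "det ?D = (\<Sum>j<p. ?D $$ (p - 1, j) * cofactor ?D (p - 1) j)"
      by (rule laplace_expansion_row[OF D]) (use i in auto)
    also have "\<dots> = (\<Sum>j<p. z j * ((-1)^(p - 1 + j) * det (mat_delete M i j)))"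
    proof (intro sum.cong refl, goal_cases)
      case (1 j)
      have "mat_delete ?D (p - 1) j = mat_delete M i j"
        by (rule eq_matI) (use M 1 i in \<open>auto simp: mat_delete_def\<close>)
      then show ?case using 1 i by (auto simp: cofactor_def mat_delete_def)
    qed
    finally have "cofactor ?N i p = (\<Sum>j<p. (-1)^(i + p) * (z j * ((-1)^(p - 1 + j) * det (mat_delete M i j))))"
      by (simp add: cofactor_def sum_distrib_left)
    also have "\<dots> = (\<Sum>j<p. - (z j * cofactor M i j))"
    proof (intro sum.cong refl, goal_cases)
      case (1 j)
      have "i + p + (p - 1 + j) = i + j + (2 * (p - 1) + 1)"
        using i by linarith
      then have "(-1::'b)^(i + p) * (-1)^(p - 1 + j) = (-1)^(i + j + (2 * (p - 1) + 1))"
        by (metis power_add)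
      also have "\<dots> = - ((-1)^(i + j))"
        by (simp add: power_add power_mult)
      finally have "(-1::'b)^(i + p) * (-1)^(p - 1 + j) = - ((-1)^(i + j))" .
      then show ?case
        by (metis (no_types, lifting) cofactor_def mult.assoc mult.left_commute mult_minus_left)
    qed
    finally show ?thesis by (simp add: sum_negf)
  qed
  have "det ?N = (\<Sum>i<p. y i * cofactor ?N i p) + w * cofactor ?N p p"
    by (simp add: d)
  also have "cofactor ?N p p = det M"
    using pp by (simp add: cofactor_def)
  also have "(\<Sum>i<p. y i * cofactor ?N i p) = - (\<Sum>i<p. \<Sum>j<p. y i * z j * cofactor M i j)"
    by (simp add: c sum_negf sum_distrib_left mult.assoc)
  finally show ?thesis by simp
qed

section \<open>Matrices as functions and their power series\<close>

text \<open>Matrices are functions on all pairs of naturals of which only the indices below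
  \<open>n\<close> count, so one type serves every size, and many equations hold only at such
  indices.\<close>

definition mmul :: "nat \<Rightarrow> (nat \<Rightarrow> nat \<Rightarrow> 'b::comm_ring_1) \<Rightarrow> (nat \<Rightarrow> nat \<Rightarrow> 'b) \<Rightarrow> nat \<Rightarrow> nat \<Rightarrow> 'b" where
  "mmul n A B = (\<lambda>i j. \<Sum>k<n. A i k * B k j)"

definition mid :: "nat \<Rightarrow> nat \<Rightarrow> 'b::comm_ring_1" where
  "mid = (\<lambda>i j. if i = j then 1 else 0)"

definition mtr :: "nat \<Rightarrow> (nat \<Rightarrow> nat \<Rightarrow> 'b::comm_ring_1) \<Rightarrow> 'b" where
  "mtr n A = (\<Sum>i<n. A i i)"

primrec mpow :: "nat \<Rightarrow> (nat \<Rightarrow> nat \<Rightarrow> 'b::comm_ring_1) \<Rightarrow> nat \<Rightarrow> nat \<Rightarrow> nat \<Rightarrow> 'b" where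
  "mpow n A 0 = mid"
| "mpow n A (Suc m) = mmul n A (mpow n A m)"

lemma mmul_assoc: "mmul n (mmul n A B) C = mmul n A (mmul n B C)"
proof (intro ext)
  fix i j
  have "(\<Sum>l<n. (\<Sum>k<n. A i k * B k l) * C l j) = (\<Sum>l<n. \<Sum>k<n. A i k * (B k l * C l j))"
    by (simp add: sum_distrib_right mult.assoc)
  also have "\<dots> = (\<Sum>k<n. \<Sum>l<n. A i k * (B k l * C l j))"
    by (rule sum.swap)
  finally show "mmul n (mmul n A B) C i j = mmul n A (mmul n B C) i j"
    by (simp add: mmul_def sum_distrib_left)
qed

lemma mtr_mmul_commute: "mtr n (mmul n A B) = mtr n (mmul n B A)"
  unfolding mtr_def mmul_def by (subst sum.swap) (simp add: mult.commute)

lemma mmul_mid_left: "i < n \<Longrightarrow> mmul n mid A i j = A i j"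
  by (simp add: mmul_def mid_def sum.delta' if_distrib[of "\<lambda>x. x * _"] cong: if_cong)

lemma mmul_mid_right: "j < n \<Longrightarrow> mmul n A mid i j = A i j"
  by (simp add: mmul_def mid_def if_distrib[of "\<lambda>x. _ * x"] cong: if_cong)

lemma mmul_cong:
  "(\<And>k. k < n \<Longrightarrow> A i k = A' i k) \<Longrightarrow> (\<And>k. k < n \<Longrightarrow> B k j = B' k j) \<Longrightarrow> mmul n A B i j = mmul n A' B' i j"
  by (simp add: mmul_def)

lemma mtr_cong: "(\<And>i. i < n \<Longrightarrow> A i i = B i i) \<Longrightarrow> mtr n A = mtr n B"
  by (simp add: mtr_def)

text \<open>\<open>mid\<close> is neutral only at indices below \<open>n\<close>. A surrounding
  product or trace reads no other indices, so there it cancels as a plain equation.\<close>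

lemma mmul_mid_inner [simp]:
  "mmul n A (mmul n mid B) = mmul n A B" "mmul n (mmul n A mid) B = mmul n A B"
  "mtr n (mmul n mid A) = mtr n A" "mtr n (mmul n A mid) = mtr n A"
  by (auto intro!: ext mmul_cong mtr_cong simp: mmul_mid_left mmul_mid_right)

lemma mpow_add:
  assumes "i < n" "j < n"
  shows "mpow n A (p + q) i j = mmul n (mpow n A p) (mpow n A q) i j"
  using assms
proof (induction p arbitrary: i)
  case 0
  then show ?case by (simp add: mmul_mid_left)
next
  case (Suc p)
  have "mpow n A (Suc p + q) i j = mmul n A (mmul n (mpow n A p) (mpow n A q)) i j"
    using Suc by (auto intro!: mmul_cong)
  then show ?case by (simp add: mmul_assoc)
qed

section \<open>The resolvent series of a matrix and its minors\<close>

definition mgen :: "nat \<Rightarrow> (nat \<Rightarrow> nat \<Rightarrow> 'b::comm_ring_1) \<Rightarrow> nat \<Rightarrow> nat \<Rightarrow> 'b fps" where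
  "mgen n T = (\<lambda>i j. Abs_fps (\<lambda>m. mpow n T m i j))"

definition mconst :: "(nat \<Rightarrow> nat \<Rightarrow> 'b::comm_ring_1) \<Rightarrow> nat \<Rightarrow> nat \<Rightarrow> 'b fps" where
  "mconst A = (\<lambda>i j. fps_const (A i j))"

lemma mgen_nth [simp]: "mgen n T i j $ m = mpow n T m i j"
  by (simp add: mgen_def)

lemma fps_nth_mmul_mconst_left: "mmul n (mconst A) F i j $ m = mmul n A (\<lambda>i j. F i j $ m) i j"
  by (simp add: mmul_def mconst_def fps_sum_nth)

lemma fps_nth_mmul_mconst_right: "mmul n F (mconst A) i j $ m = mmul n (\<lambda>i j. F i j $ m) A i j"
  by (simp add: mmul_def mconst_def fps_sum_nth)

lemma fps_nth_mmul: "mmul n F G i j $ m = (\<Sum>p\<le>m. mmul n (\<lambda>i j. F i j $ p) (\<lambda>i j. G i j $ (m - p)) i j)"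
  unfolding mmul_def fps_sum_nth fps_mult_nth atLeast0AtMost by (rule sum.swap)

lemma mpow_commute:
  assumes "i < n" "j < n"
  shows "mmul n (mpow n T m) T i j = mpow n T (Suc m) i j"
proof -
  have "mpow n T (m + 1) i j = mmul n (mpow n T m) (mpow n T 1) i j"
    using assms by (rule mpow_add)
  also have "mpow n T 1 = mmul n T mid" by simp
  also have "mmul n (mpow n T m) \<dots> i j = mmul n (mpow n T m) T i j"
    using assms by (auto intro!: mmul_cong simp: mmul_mid_right)
  finally show ?thesis by simp
qed

text \<open>The series G is the Neumann series of the inverse of 1 - uT, hence G' = G T G. In the
  coefficient of u^m each of the m + 1 places for the middle \<open>T\<close> contributes the same
  power of \<open>T\<close>.\<close>

lemma fps_deriv_mgen:
  assumes "i < n" "j < n"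
  shows "fps_deriv (mgen n T i j) = mmul n (mmul n (mgen n T) (mconst T)) (mgen n T) i j"
proof (rule fps_ext)
  fix m
  have "mmul n (mmul n (mgen n T) (mconst T)) (mgen n T) i j $ m
     = (\<Sum>p\<le>m. mmul n (mmul n (mpow n T p) T) (mpow n T (m - p)) i j)"
    by (subst fps_nth_mmul) (simp only: fps_nth_mmul_mconst_right mgen_nth)
  also have "\<dots> = (\<Sum>p\<le>m. mpow n T (Suc m) i j)"
  proof (intro sum.cong refl)
    fix p assume p: "p \<in> {..m}"
    have "mmul n (mmul n (mpow n T p) T) (mpow n T (m - p)) i j = mmul n (mpow n T (Suc p)) (mpow n T (m - p)) i j"
      using assms by (intro mmul_cong mpow_commute) auto
    also have "\<dots> = mpow n T (Suc p + (m - p)) i j"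
      using assms by (simp only: mpow_add)
    also have "Suc p + (m - p) = Suc m" using p by simp
    finally show "mmul n (mmul n (mpow n T p) T) (mpow n T (m - p)) i j = mpow n T (Suc m) i j" .
  qed
  finally show "fps_deriv (mgen n T i j) $ m = mmul n (mmul n (mgen n T) (mconst T)) (mgen n T) i j $ m"
    by (simp add: algebra_simps)
qed

lemma mtr_mgen_mconst:
  assumes "\<And>m. mtr n (mpow n T (Suc m)) = 0"
  shows "mtr n (mmul n (mgen n T) (mconst T)) = 0"
proof (rule fps_ext)
  fix m
  have "mtr n (mmul n (mgen n T) (mconst T)) $ m = mtr n (mmul n (mpow n T m) T)"
    by (simp add: mtr_def fps_sum_nth fps_nth_mmul_mconst_right)
  also have "\<dots> = mtr n (mpow n T (Suc m))"
    by (intro mtr_cong mpow_commute)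
  finally show "mtr n (mmul n (mgen n T) (mconst T)) $ m = 0 $ m"
    using assms by simp
qed

definition minor :: "(nat \<Rightarrow> nat \<Rightarrow> 'b::comm_ring_1) \<Rightarrow> nat \<Rightarrow> (nat \<Rightarrow> nat) \<Rightarrow> (nat \<Rightarrow> nat) \<Rightarrow> 'b" where
  "minor G p a b = det (mat p p (\<lambda>(i,j). G (a i) (b j)))"

text \<open>By Jacobi's formula and G' = G T G the derivative is a sum of terms
  \<open>?G (a i) c * T c d * ?G d (b j)\<close> times cofactors. Bordering by row \<open>d\<close>
  and column \<open>c\<close> gives the negative of these terms and a multiple of tr (T G), which is
  0.\<close>

lemma fps_deriv_minor:
  fixes T :: "nat \<Rightarrow> nat \<Rightarrow> 'b::comm_ring_1"
  assumes tr: "\<And>m. mtr n (mpow n T (Suc m)) = 0"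
    and a: "\<And>i. i < p \<Longrightarrow> a i < n" and b: "\<And>i. i < p \<Longrightarrow> b i < n"
  shows "fps_deriv (minor (mgen n T) p a b)
     = - (\<Sum>c<n. \<Sum>d<n. fps_const (T c d) * minor (mgen n T) (Suc p) (a(p := d)) (b(p := c)))"
proof -
  let ?G = "mgen n T"
  let ?M = "mat p p (\<lambda>(i,j). ?G (a i) (b j))"
  have M: "?M \<in> carrier_mat p p" by simp
  have eq: "minor ?G (Suc p) (a(p := d)) (b(p := c))
     = ?G d c * det ?M - (\<Sum>i<p. \<Sum>j<p. ?G (a i) c * ?G d (b j) * cofactor ?M i j)" for c d
    unfolding minor_def det_bordered[OF M, symmetric]
    by (intro arg_cong[of _ _ det] eq_matI) auto
  have "(\<Sum>c<n. \<Sum>d<n. fps_const (T c d) * minor ?G (Suc p) (a(p := d)) (b(p := c)))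
     = (\<Sum>c<n. \<Sum>d<n. fps_const (T c d) * ?G d c) * det ?M
       - (\<Sum>c<n. \<Sum>d<n. \<Sum>i<p. \<Sum>j<p. ?G (a i) c * fps_const (T c d) * ?G d (b j) * cofactor ?M i j)"
    unfolding eq by (simp add: right_diff_distrib sum_subtractf sum_distrib_left sum_distrib_right mult.assoc mult.left_commute)
  also have "(\<Sum>c<n. \<Sum>d<n. fps_const (T c d) * ?G d c) = mtr n (mmul n (mconst T) ?G)"
    by (simp add: mtr_def mmul_def mconst_def)
  also have "\<dots> = 0"
    by (subst mtr_mmul_commute) (rule mtr_mgen_mconst[OF tr])
  also have "(\<Sum>c<n. \<Sum>d<n. \<Sum>i<p. \<Sum>j<p. ?G (a i) c * fps_const (T c d) * ?G d (b j) * cofactor ?M i j)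
     = (\<Sum>i<p. \<Sum>j<p. (\<Sum>d<n. \<Sum>c<n. ?G (a i) c * fps_const (T c d) * ?G d (b j)) * cofactor ?M i j)"
    (is "(\<Sum>c<n. \<Sum>d<n. \<Sum>i<p. \<Sum>j<p. ?X c d i j) = _")
  proof -
    have "(\<Sum>c<n. \<Sum>d<n. \<Sum>i<p. \<Sum>j<p. ?X c d i j) = (\<Sum>d<n. \<Sum>c<n. \<Sum>i<p. \<Sum>j<p. ?X c d i j)"
      by (rule sum.swap)
    also have "\<dots> = (\<Sum>d<n. \<Sum>i<p. \<Sum>c<n. \<Sum>j<p. ?X c d i j)"
      by (intro sum.cong refl sum.swap)
    also have "\<dots> = (\<Sum>i<p. \<Sum>d<n. \<Sum>c<n. \<Sum>j<p. ?X c d i j)"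
      by (rule sum.swap)
    also have "\<dots> = (\<Sum>i<p. \<Sum>d<n. \<Sum>j<p. \<Sum>c<n. ?X c d i j)"
      by (intro sum.cong refl sum.swap)
    also have "\<dots> = (\<Sum>i<p. \<Sum>j<p. \<Sum>d<n. \<Sum>c<n. ?X c d i j)"
      by (intro sum.cong refl sum.swap)
    finally show ?thesis by (simp add: sum_distrib_right)
  qed
  also have "\<dots> = (\<Sum>i<p. \<Sum>j<p. fps_deriv (?M $$ (i,j)) * cofactor ?M i j)"
    using a b by (intro sum.cong refl) (simp add: fps_deriv_mgen, simp add: mmul_def mconst_def sum_distrib_right)
  also have "\<dots> = fps_deriv (minor ?G p a b)"
    unfolding minor_def by (rule fps_deriv_det[OF M, symmetric])
  finally show ?thesis by (simp only: mult_zero_left diff_0 minus_minus)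
qed

text \<open>Descending induction on \<open>p\<close>: an \<open>(n+1)\<close>-minor has two equal rows, and the derivative of a
  \<open>p\<close>-minor is a combination of \<open>(p+1)\<close>-minors.\<close>

lemma minor_mgen_nth_eq_0:
  fixes T :: "nat \<Rightarrow> nat \<Rightarrow> 'b::comm_ring_1"
  assumes tr: "\<And>m. mtr n (mpow n T (Suc m)) = 0"
    and tf: "\<And>m (x::'b). of_nat (Suc m) * x = 0 \<Longrightarrow> x = 0"
    and "\<And>i. i < p \<Longrightarrow> a i < n" "\<And>i. i < p \<Longrightarrow> b i < n"
    and "m + p > n"
  shows "minor (mgen n T) p a b $ m = 0"
  using assms(3-)
proof (induction "Suc n - p" arbitrary: p a b m)
  case 0
  then have "card {..<p} > card {..<n}" by simp
  moreover have "a ` {..<p} \<subseteq> {..<n}" using 0 by auto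
  ultimately have "\<not> inj_on a {..<p}"
    by (metis card_inj_on_le finite_lessThan leD)
  then obtain i j where ij: "i < p" "j < p" "i \<noteq> j" "a i = a j"
    by (auto simp: inj_on_def)
  have "minor (mgen n T) p a b = 0"
    unfolding minor_def
    by (rule det_identical_rows[where i = i and j = j and n = p]) (use ij in \<open>auto intro!: eq_vecI\<close>)
  then show ?case by simp
next
  case (Suc q)
  show ?case
  \<comment> \<open>For m = 0 the degree hypothesis would force p > n, against
    \<open>Suc q = Suc n - p\<close>.\<close>
  proof (cases "m = 0")
    case True
    then show ?thesis using Suc by simp
  next
    case False
    then obtain m' where m': "m = Suc m'" by (cases m) auto
    have "minor (mgen n T) (Suc p) (a(p := d)) (b(p := c)) $ m' = 0" if "c < n" "d < n" for c d
      by (rule Suc.hyps(1)) (use Suc.hyps(2) Suc.prems m' that in auto)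
    then have "fps_deriv (minor (mgen n T) p a b) $ m' = 0"
      using Suc.prems by (subst fps_deriv_minor[OF tr]) (simp_all add: fps_sum_nth)
    then show ?thesis using tf m' by simp
  qed
qed

section \<open>Trace identities for small minors\<close>

lemma mat_delete_mat:
  "mat_delete (mat (Suc m) (Suc m) f) i j
     = mat m m (\<lambda>(r,c). f (if r < i then r else Suc r, if c < j then c else Suc c))"
  by (rule eq_matI) (auto simp: mat_delete_def)

lemma det_mat_Suc:
  "det (mat (Suc m) (Suc m) f)
     = (\<Sum>i<Suc m. f (i, 0) * ((-1)^i * det (mat m m (\<lambda>(r,c). f (if r < i then r else Suc r, Suc c)))))"
  by (subst laplace_expansion_column[of _ "Suc m" 0]) (auto simp: cofactor_def mat_delete_mat)

lemma minor_1: "minor G (Suc 0) a b = G (a 0) (b 0)"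
  by (simp add: minor_def det_single)

lemma det_2: "det (mat 2 2 f) = f (0, 0) * f (1, 1) - f (0, 1) * f (1, 0)"
proof -
  have 2: "{..<Suc 1} = {0, 1}" "2 = Suc 1" by auto
  show ?thesis unfolding 2(2) det_mat_Suc 2(1) by (simp add: det_single)
qed

lemma det_3: "det (mat 3 3 f) = f (0, 0) * (f (1, 1) * f (2, 2) - f (1, 2) * f (2, 1))
   - f (1, 0) * (f (0, 1) * f (2, 2) - f (0, 2) * f (2, 1))
   + f (2, 0) * (f (0, 1) * f (1, 2) - f (0, 2) * f (1, 1))"
proof -
  have 3: "{..<Suc 2} = {0, 1, 2}" "3 = Suc 2" by auto
  show ?thesis unfolding 3(2) det_mat_Suc 3(1) by (simp add: det_2 One_nat_def[symmetric] algebra_simps del: One_nat_def)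
qed

lemma minor_2: "minor G 2 a b = G (a 0) (b 0) * G (a 1) (b 1) - G (a 0) (b 1) * G (a 1) (b 0)"
  by (simp add: minor_def det_2)

lemma minor_3: "minor G 3 a b =
    (G (a 0) (b 0) * G (a 1) (b 1) - G (a 0) (b 1) * G (a 1) (b 0)) * G (a 2) (b 2)
    - G (a 0) (b 0) * (G (a 1) (b 2) * G (a 2) (b 1))
    + G (a 0) (b 1) * (G (a 1) (b 2) * G (a 2) (b 0))
    + G (a 1) (b 0) * (G (a 0) (b 2) * G (a 2) (b 1))
    - G (a 1) (b 1) * (G (a 0) (b 2) * G (a 2) (b 0))"
  unfolding minor_def by (subst det_3) (simp, simp only: algebra_simps)

section \<open>Contraction of minors with fixed matrices\<close>

definition contr :: "nat \<Rightarrow> (nat \<Rightarrow> nat \<Rightarrow> 'b::comm_ring_1) \<Rightarrow> (nat \<Rightarrow> nat \<Rightarrow> 'b) \<Rightarrow> 'b" where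
  "contr n B X = (\<Sum>a<n. \<Sum>b<n. X a b * B b a)"

lemma contr_eq_mtr: "contr n B X = mtr n (mmul n X B)"
  by (simp add: contr_def mtr_def mmul_def)

lemma contr_diff: "contr n B (\<lambda>a b. X a b - Y a b) = contr n B X - contr n B Y"
  by (simp add: contr_def sum_subtractf algebra_simps)

lemma contr_add: "contr n B (\<lambda>a b. X a b + Y a b) = contr n B X + contr n B Y"
  by (simp add: contr_def sum.distrib algebra_simps)

lemma contr_mult_left: "contr n B (\<lambda>a b. k * X a b) = k * contr n B X"
  by (simp add: contr_def sum_distrib_left mult.assoc)

lemma contr_mult_right: "contr n B (\<lambda>a b. X a b * k) = contr n B X * k"
  unfolding contr_def sum_distrib_right by (simp add: ac_simps)

text \<open>Contracting a pair of indices that sit in two different factors joins these factors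
  through \<open>B\<close>. Thus the nontrivial permutations in a determinant give rise to the
  longer traces.\<close>

lemma contr_cross1: "contr n B (\<lambda>a b. x i b * y a j) = mmul n (mmul n x B) y i j"
  unfolding contr_def mmul_def sum_distrib_right by (simp add: ac_simps)

lemma contr_cross2: "contr n B (\<lambda>a b. x a i * y j b) = mmul n (mmul n y B) x j i"
  unfolding contr_def mmul_def sum_distrib_right by (simp add: ac_simps)

definition tr1 :: "nat \<Rightarrow> (nat \<Rightarrow> nat \<Rightarrow> 'b::comm_ring_1) \<Rightarrow> (nat \<Rightarrow> nat \<Rightarrow> 'b) \<Rightarrow> 'b" where
  "tr1 n G A = mtr n (mmul n G A)"
definition tr2 :: "nat \<Rightarrow> (nat \<Rightarrow> nat \<Rightarrow> 'b::comm_ring_1) \<Rightarrow> (nat \<Rightarrow> nat \<Rightarrow> 'b) \<Rightarrow> (nat \<Rightarrow> nat \<Rightarrow> 'b) \<Rightarrow> 'b" where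
  "tr2 n G A B = mtr n (mmul n G (mmul n A (mmul n G B)))"
definition tr3 :: "nat \<Rightarrow> (nat \<Rightarrow> nat \<Rightarrow> 'b::comm_ring_1) \<Rightarrow> (nat \<Rightarrow> nat \<Rightarrow> 'b) \<Rightarrow> (nat \<Rightarrow> nat \<Rightarrow> 'b) \<Rightarrow> (nat \<Rightarrow> nat \<Rightarrow> 'b) \<Rightarrow> 'b" where
  "tr3 n G A B C = mtr n (mmul n G (mmul n A (mmul n G (mmul n B (mmul n G C)))))"

lemma tr2_commute: "tr2 n G A B = tr2 n G B A"
  unfolding tr2_def
  by (subst mmul_assoc[symmetric], subst mtr_mmul_commute) (simp add: mmul_assoc)

lemma tr3_rotate: "tr3 n G A B C = tr3 n G B C A"
  unfolding tr3_def
  by (subst mmul_assoc[symmetric], subst mtr_mmul_commute) (simp add: mmul_assoc)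

definition cyc3 where "cyc3 n G A B C = tr3 n G A B C + tr3 n G A C B"

text \<open>Contraction turns a degree bound for all minors into one for traces. For
  \<open>A = B\<close> this is twice the second elementary symmetric function of the matrix
  \<open>G A\<close>.\<close>

definition minors2 :: "nat \<Rightarrow> (nat \<Rightarrow> nat \<Rightarrow> 'b::comm_ring_1) \<Rightarrow> (nat \<Rightarrow> nat \<Rightarrow> 'b) \<Rightarrow> (nat \<Rightarrow> nat \<Rightarrow> 'b) \<Rightarrow> 'b" where
  "minors2 n G A B = contr n A (\<lambda>a0 b0. contr n B (\<lambda>a1 b1.
     minor G 2 (\<lambda>i. [a0, a1] ! i) (\<lambda>i. [b0, b1] ! i)))"

definition minors3 :: "nat \<Rightarrow> (nat \<Rightarrow> nat \<Rightarrow> 'b::comm_ring_1) \<Rightarrow> (nat \<Rightarrow> nat \<Rightarrow> 'b) \<Rightarrow> (nat \<Rightarrow> nat \<Rightarrow> 'b) \<Rightarrow> (nat \<Rightarrow> nat \<Rightarrow> 'b) \<Rightarrow> 'b" where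
  "minors3 n G A B C = contr n A (\<lambda>a0 b0. contr n B (\<lambda>a1 b1. contr n C (\<lambda>a2 b2.
     minor G 3 (\<lambda>i. [a0, a1, a2] ! i) (\<lambda>i. [b0, b1, b2] ! i))))"

lemma minors2_eq: "minors2 n G A B = tr1 n G A * tr1 n G B - tr2 n G A B"
proof -
  have 1: "contr n B (\<lambda>a1 b1. minor G 2 (\<lambda>i. [a0, a1] ! i) (\<lambda>i. [b0, b1] ! i))
     = tr1 n G B * G a0 b0 - mmul n (mmul n G B) G a0 b0" for a0 b0
    by (simp add: minor_2 contr_diff contr_mult_left contr_cross1 contr_eq_mtr[of n B G] tr1_def)
  show ?thesis
    unfolding minors2_def 1
    unfolding contr_diff contr_mult_left
    unfolding contr_eq_mtr
    unfolding tr2_commute[of n G A B] by (simp add: tr1_def tr2_def mmul_assoc)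
qed

text \<open>The six permutations contract to products of traces along their cycles: a triple
  product, three terms for the transpositions, and the two 3-cycles collected in
  \<open>cyc3\<close>.\<close>

lemma minors3_eq: "minors3 n G A B C = cyc3 n G A B C + tr1 n G A * tr1 n G B * tr1 n G C
    - tr1 n G A * tr2 n G B C - tr1 n G B * tr2 n G A C - tr1 n G C * tr2 n G A B"
proof -
  define H where "H = mmul n (mmul n G C) G"
  have 1: "contr n C (\<lambda>a2 b2. minor G 3 (\<lambda>i. [a0, a1, a2] ! i) (\<lambda>i. [b0, b1, b2] ! i))
     = (G a0 b0 * G a1 b1 - G a0 b1 * G a1 b0) * tr1 n G C - G a0 b0 * H a1 b1
       + G a0 b1 * H a1 b0 + G a1 b0 * H a0 b1 - G a1 b1 * H a0 b0" for a0 a1 b0 b1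
    by (simp add: minor_3 contr_diff contr_add contr_mult_left contr_cross1
        contr_eq_mtr[of n C G] tr1_def H_def numeral_2_eq_2)
  have 2: "contr n B (\<lambda>a1 b1. (G a0 b0 * G a1 b1 - G a0 b1 * G a1 b0) * tr1 n G C - G a0 b0 * H a1 b1
       + G a0 b1 * H a1 b0 + G a1 b0 * H a0 b1 - G a1 b1 * H a0 b0)
     = (G a0 b0 * tr1 n G B - mmul n (mmul n G B) G a0 b0) * tr1 n G C - G a0 b0 * mtr n (mmul n H B)
       + mmul n (mmul n G B) H a0 b0 + mmul n (mmul n H B) G a0 b0 - tr1 n G B * H a0 b0" for a0 b0
    unfolding contr_diff contr_add contr_mult_left contr_mult_right contr_cross1 contr_cross2
    by (simp add: contr_eq_mtr tr1_def)
  have 3: "mtr n (mmul n H B) = tr2 n G B C" "mtr n (mmul n H A) = tr2 n G A C"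
    unfolding H_def tr2_commute[of n G _ C] by (simp_all add: tr2_def mmul_assoc)
  have 4: "mtr n (mmul n (mmul n (mmul n G B) H) A) = tr3 n G A B C"
    unfolding H_def tr3_rotate[of n G A B C] by (simp add: tr3_def mmul_assoc)
  have 5: "mtr n (mmul n (mmul n (mmul n H B) G) A) = tr3 n G A C B"
    unfolding H_def tr3_rotate[of n G A C B] by (simp add: tr3_def mmul_assoc)
  have 6: "mtr n (mmul n (mmul n (mmul n G B) G) A) = tr2 n G A B"
    unfolding tr2_commute[of n G A B] by (simp add: tr2_def mmul_assoc)
  show ?thesis
    unfolding minors3_def 1 2
    unfolding contr_diff contr_add contr_mult_left contr_mult_right
    unfolding contr_eq_mtr
    unfolding 3 4 5 6
    by (simp add: tr1_def cyc3_def algebra_simps)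
qed


lemma fps_nth_contr_mconst: "contr n (mconst A) X $ m = contr n A (\<lambda>a b. X a b $ m)"
  by (simp add: contr_def mconst_def fps_sum_nth)

lemma contr_eq_0: "(\<And>a b. a < n \<Longrightarrow> b < n \<Longrightarrow> X a b = 0) \<Longrightarrow> contr n A X = 0"
  by (simp add: contr_def)

text \<open>The bounds \<open>d\<close> and \<open>e\<close> are strict, so the product has degree
  at most d + e - 2; hence m + 1 in the hypothesis.\<close>

lemma fps_mult_nth_eq_0:
  fixes f g :: "'b::comm_ring_1 fps"
  assumes "\<And>m. m \<ge> d \<Longrightarrow> f $ m = 0" "\<And>m. m \<ge> e \<Longrightarrow> g $ m = 0" "m + 1 \<ge> d + e"
  shows "(f * g) $ m = 0"
  unfolding fps_mult_nth
proof (intro sum.neutral ballI)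
  fix i assume "i \<in> {0..m}"
  then have "i \<ge> d \<or> m - i \<ge> e" using assms(3) by auto
  then show "f $ i * g $ (m - i) = 0" using assms by auto
qed

text \<open>On the triangle \<open>i + j + k = 2N\<close> with \<open>i, j, k \<le> N\<close> the three weights \<open>N - i\<close>, \<open>N - j\<close>, \<open>N - k\<close>
  add up to \<open>N\<close>, and each of them kills the coefficient, because it vanishes at the top index.\<close>

lemma triple_product_nth_eq_0:
  fixes f g h :: "'b::comm_ring_1 fps"
  assumes tf: "\<And>m (x::'b). of_nat (Suc m) * x = 0 \<Longrightarrow> x = 0"
    and N: "N > 0"
    and v: "\<And>m. m > N \<Longrightarrow> f $ m = 0" "\<And>m. m > N \<Longrightarrow> g $ m = 0" "\<And>m. m > N \<Longrightarrow> h $ m = 0"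
    and w: "\<And>m. m > N \<Longrightarrow> (f * g) $ m = 0" "\<And>m. m > N \<Longrightarrow> (f * h) $ m = 0" "\<And>m. m > N \<Longrightarrow> (g * h) $ m = 0"
  shows "(f * g * h) $ (2 * N) = 0"
proof -
  \<comment> \<open>\<open>D\<close> weights the coefficient of index m by N - m; it therefore
    removes the top coefficient of a series of degree at most \<open>N\<close>.\<close>
  define D where "D x = of_nat N * x - fps_X * fps_deriv x" for x :: "'b fps"
  have Dnth: "D x $ m = (of_nat N - of_nat m) * x $ m" for x m
    by (cases m) (simp_all add: D_def fps_X_mult_nth fps_of_nat[symmetric] algebra_simps)
  have D0: "D x $ m = 0" if "\<And>m. m > N \<Longrightarrow> x $ m = 0" "m \<ge> N" for x m
    using that by (cases "m = N") (auto simp: Dnth)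
  have z: "(D x * y) $ (2 * N) = 0" if "\<And>m. m > N \<Longrightarrow> x $ m = 0" "\<And>m. m > N \<Longrightarrow> y $ m = 0" for x y
    by (rule fps_mult_nth_eq_0[where d = N and e = "Suc N"]) (use that D0 in auto)
  \<comment> \<open>By the product rule the three weights sum to 3N minus the total index. At index
    2N the left-hand side carries the factor -N + 2N = N.\<close>
  have e: "D (f * g * h) + of_nat (2 * N) * (f * g * h) = D f * (g * h) + D g * (f * h) + D h * (f * g)"
    by (simp add: D_def algebra_simps)
  have "D (f * g * h) $ (2 * N) + of_nat (2 * N) * (f * g * h) $ (2 * N) = 0"
    using arg_cong[OF e, of "\<lambda>x. x $ (2 * N)"] z[of f "g * h"] z[of g "f * h"] z[of h "f * g"] v w
    by (simp add: fps_of_nat[symmetric])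
  then have "of_nat N * (f * g * h) $ (2 * N) = 0"
    by (simp add: Dnth algebra_simps)
  then show ?thesis using tf[of "N - 1"] N by simp
qed

section \<open>Degree bounds for matrices whose powers have trace zero\<close>

locale traceless_powers =
  fixes n :: nat and T :: "nat \<Rightarrow> nat \<Rightarrow> 'b::comm_ring_1"
  assumes torsion_free: "\<And>m (x::'b). of_nat (Suc m) * x = 0 \<Longrightarrow> x = 0"
    and mtr_mpow: "\<And>m. mtr n (mpow n T (Suc m)) = 0"
begin

abbreviation "\<tau>\<^sub>1 A \<equiv> tr1 n (mgen n T) (mconst A)"
abbreviation "\<tau>\<^sub>2 A B \<equiv> tr2 n (mgen n T) (mconst A) (mconst B)"
abbreviation "J A B \<equiv> minors2 n (mgen n T) (mconst A) (mconst B)"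
abbreviation "K A B C \<equiv> minors3 n (mgen n T) (mconst A) (mconst B) (mconst C)"
abbreviation "cyc A B C \<equiv> cyc3 n (mgen n T) (mconst A) (mconst B) (mconst C)"

text \<open>The 1-minors of the series are its entries. This is the nilpotency usually derived from
  Newton's identities and Cayley-Hamilton.\<close>

lemma mpow_eq_0:
  assumes "i < n" "j < n" "m \<ge> n"
  shows "mpow n T m i j = 0"
  using minor_mgen_nth_eq_0[OF mtr_mpow torsion_free, where p = "Suc 0" and a = "\<lambda>_. i" and b = "\<lambda>_. j" and m = m] assms
  by (simp add: minor_1)

lemma t_nth_eq_0: "m \<ge> n \<Longrightarrow> \<tau>\<^sub>1 A $ m = 0"
  by (simp add: tr1_def contr_eq_mtr[symmetric] fps_nth_contr_mconst contr_eq_0 mpow_eq_0)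

lemma J_nth_eq_0: "m + 2 > n \<Longrightarrow> J A B $ m = 0"
  unfolding minors2_def fps_nth_contr_mconst
  by (intro contr_eq_0 minor_mgen_nth_eq_0[OF mtr_mpow torsion_free]) (auto simp: less_2_cases_iff)

lemma K_nth_eq_0: "m + 3 > n \<Longrightarrow> K A B C $ m = 0"
  unfolding minors3_def fps_nth_contr_mconst
  by (intro contr_eq_0 minor_mgen_nth_eq_0[OF mtr_mpow torsion_free])
    (auto simp: numeral_3_eq_3 less_Suc_eq)

text \<open>Under the trace such an \<open>A'\<close> acts like \<open>T A\<close>, so
  multiplication by the variable shifts the series by one place and loses only its constant
  term.\<close>

lemma t_shift:
  assumes "\<And>m. mtr n (mmul n (mpow n T m) A') = mtr n (mmul n (mpow n T (Suc m)) A)"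
  shows "fps_X * \<tau>\<^sub>1 A' = \<tau>\<^sub>1 A - fps_const (mtr n A)"
proof (rule fps_ext)
  have t: "\<tau>\<^sub>1 A $ m = mtr n (mmul n (mpow n T m) A)" for A m
    by (simp add: tr1_def contr_eq_mtr[symmetric] fps_nth_contr_mconst)
  fix m
  show "(fps_X * \<tau>\<^sub>1 A') $ m = (\<tau>\<^sub>1 A - fps_const (mtr n A)) $ m"
    using assms by (cases m) (simp_all add: t fps_X_mult_nth del: mpow.simps(2))
qed

text \<open>Splitting off the constant term of either factor writes twice the product as terms of
  degree below \<open>n\<close> plus u times products with one primed letter. Those products are
  2-minors up to \<open>\<tau>\<^sub>2\<close> terms, which cancel by hypothesis, and 2-minors have
  degree at most n - 2.\<close>

lemma t_mult_nth_eq_0: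
  assumes "fps_X * \<tau>\<^sub>1 A' = \<tau>\<^sub>1 A - fps_const (mtr n A)" "fps_X * \<tau>\<^sub>1 B' = \<tau>\<^sub>1 B - fps_const (mtr n B)"
    and "\<tau>\<^sub>2 A' B + \<tau>\<^sub>2 A B' = 0" and n: "n > 0" and m: "m \<ge> n"
  shows "(\<tau>\<^sub>1 A * \<tau>\<^sub>1 B) $ m = 0"
proof -
  have "2 * (\<tau>\<^sub>1 A * \<tau>\<^sub>1 B) = fps_const (mtr n A) * \<tau>\<^sub>1 B + fps_const (mtr n B) * \<tau>\<^sub>1 A
      + fps_X * \<tau>\<^sub>1 A' * \<tau>\<^sub>1 B + \<tau>\<^sub>1 A * (fps_X * \<tau>\<^sub>1 B')"
    unfolding assms(1,2) by (simp add: algebra_simps)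
  also have "\<dots> = fps_const (mtr n A) * \<tau>\<^sub>1 B + fps_const (mtr n B) * \<tau>\<^sub>1 A
      + fps_X * (J A' B + J A B' + (\<tau>\<^sub>2 A' B + \<tau>\<^sub>2 A B'))"
    by (simp add: minors2_eq algebra_simps)
  finally have "2 * (\<tau>\<^sub>1 A * \<tau>\<^sub>1 B) = fps_const (mtr n A) * \<tau>\<^sub>1 B + fps_const (mtr n B) * \<tau>\<^sub>1 A
      + fps_X * (J A' B + J A B')"
    using assms(3) by simp
  moreover have "(fps_X * (J A' B + J A B')) $ m = 0"
    using m n by (simp add: fps_X_mult_nth J_nth_eq_0)
  ultimately have "(2 * (\<tau>\<^sub>1 A * \<tau>\<^sub>1 B)) $ m = 0"
    using m by (simp add: t_nth_eq_0)
  then show ?thesis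
    using torsion_free[of 1 "(\<tau>\<^sub>1 A * \<tau>\<^sub>1 B) $ m"] by (simp add: numeral_fps_const)
qed

text \<open>With \<open>F = \<Sum> s\<^sup>m X\<^sup>m\<close> and \<open>u = s\<^sup>2\<close>, the left-hand side is the part of \<open>tr (F A F B F C)\<close> of even degree
  in \<open>s\<close>, symmetrised over the two cyclic orders; a primed letter arises when two odd powers of \<open>X\<close> meet around it.\<close>

lemma cyc_total_nth_eq_0:
  assumes A: "fps_X * \<tau>\<^sub>1 A' = \<tau>\<^sub>1 A - fps_const (mtr n A)"
    and B: "fps_X * \<tau>\<^sub>1 B' = \<tau>\<^sub>1 B - fps_const (mtr n B)"
    and C: "fps_X * \<tau>\<^sub>1 C' = \<tau>\<^sub>1 C - fps_const (mtr n C)"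
    and AB: "\<tau>\<^sub>2 A' B + \<tau>\<^sub>2 A B' = 0" and AC: "\<tau>\<^sub>2 A' C + \<tau>\<^sub>2 A C' = 0" and BC: "\<tau>\<^sub>2 B' C + \<tau>\<^sub>2 B C' = 0"
    and n: "n \<ge> 2"
  shows "(cyc A B C + fps_X * (cyc A' B C + cyc A B' C + cyc A B C')) $ (2 * n - 2) = 0"
proof -
  have cyc: "cyc A B C = K A B C - \<tau>\<^sub>1 A * \<tau>\<^sub>1 B * \<tau>\<^sub>1 C + \<tau>\<^sub>1 A * \<tau>\<^sub>2 B C + \<tau>\<^sub>1 B * \<tau>\<^sub>2 A C + \<tau>\<^sub>1 C * \<tau>\<^sub>2 A B" for A B C
    by (simp add: minors3_eq)
  have "cyc A B C + fps_X * (cyc A' B C + cyc A B' C + cyc A B C')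
     = K A B C + fps_X * (K A' B C + K A B' C + K A B C')
      - \<tau>\<^sub>1 A * \<tau>\<^sub>1 B * \<tau>\<^sub>1 C + \<tau>\<^sub>1 A * \<tau>\<^sub>2 B C + \<tau>\<^sub>1 B * \<tau>\<^sub>2 A C + \<tau>\<^sub>1 C * \<tau>\<^sub>2 A B
      - (fps_X * \<tau>\<^sub>1 A') * \<tau>\<^sub>1 B * \<tau>\<^sub>1 C - \<tau>\<^sub>1 A * (fps_X * \<tau>\<^sub>1 B') * \<tau>\<^sub>1 C - \<tau>\<^sub>1 A * \<tau>\<^sub>1 B * (fps_X * \<tau>\<^sub>1 C')
      + (fps_X * \<tau>\<^sub>1 A') * \<tau>\<^sub>2 B C + (fps_X * \<tau>\<^sub>1 B') * \<tau>\<^sub>2 A C + (fps_X * \<tau>\<^sub>1 C') * \<tau>\<^sub>2 A B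
      + fps_X * (\<tau>\<^sub>1 A * (\<tau>\<^sub>2 B' C + \<tau>\<^sub>2 B C') + \<tau>\<^sub>1 B * (\<tau>\<^sub>2 A' C + \<tau>\<^sub>2 A C') + \<tau>\<^sub>1 C * (\<tau>\<^sub>2 A' B + \<tau>\<^sub>2 A B'))"
    unfolding cyc by (simp add: algebra_simps)
  \<comment> \<open>Each \<open>fps_X * \<tau>\<^sub>1 A'\<close> becomes
    \<open>\<tau>\<^sub>1 A\<close> minus a constant, each remaining \<open>\<tau>\<^sub>2\<close> a
    product minus \<open>J\<close>. The triple product then occurs -4 + 6 = 2 times, and the terms
    with one trace constant and two \<open>\<tau>\<^sub>1\<close> cancel.\<close>
  also have "\<dots> = K A B C + fps_X * (K A' B C + K A B' C + K A B C')
      + 2 * (\<tau>\<^sub>1 A * \<tau>\<^sub>1 B * \<tau>\<^sub>1 C) - 2 * (\<tau>\<^sub>1 A * J B C + \<tau>\<^sub>1 B * J A C + \<tau>\<^sub>1 C * J A B)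
      + fps_const (mtr n A) * J B C + fps_const (mtr n B) * J A C + fps_const (mtr n C) * J A B"
    unfolding A B C AB AC BC by (simp add: minors2_eq algebra_simps)
  finally have eq: "cyc A B C + fps_X * (cyc A' B C + cyc A B' C + cyc A B C') = \<dots>" .
  \<comment> \<open>The factors have degree at most n - 1 and n - 2, so the product stops at 2n -
    3.\<close>
  have tJ: "(\<tau>\<^sub>1 X * J Y Z) $ (2 * n - 2) = 0" for X Y Z
    by (rule fps_mult_nth_eq_0[where d = n and e = "n - 1"]) (use n in \<open>auto intro: t_nth_eq_0 J_nth_eq_0\<close>)
  \<comment> \<open>The triple product lemma is used with N = n - 1, which is positive because n is
    at least 2.\<close>
  have "(\<tau>\<^sub>1 A * \<tau>\<^sub>1 B * \<tau>\<^sub>1 C) $ (2 * (n - 1)) = 0"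
    by (rule triple_product_nth_eq_0[OF torsion_free])
      (use n in \<open>auto intro: t_nth_eq_0 t_mult_nth_eq_0[OF A B AB] t_mult_nth_eq_0[OF A C AC] t_mult_nth_eq_0[OF B C BC]\<close>)
  then have ttt: "(\<tau>\<^sub>1 A * \<tau>\<^sub>1 B * \<tau>\<^sub>1 C) $ (2 * n - 2) = 0"
    by (simp add: right_diff_distrib')
  show ?thesis
    unfolding eq using n
    by (simp add: tJ ttt K_nth_eq_0 J_nth_eq_0 fps_X_mult_nth numeral_fps_const)
qed

end

section \<open>Combinations of matrices with anticommuting coefficients\<close>

lemma mmul_sum_left: "mmul n (\<lambda>i j. \<Sum>t\<in>S. P t i j) B = (\<lambda>i j. \<Sum>t\<in>S. mmul n (P t) B i j)"
  unfolding mmul_def sum_distrib_right by (intro ext sum.swap)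

lemma mmul_sum_right: "mmul n A (\<lambda>i j. \<Sum>t\<in>S. P t i j) = (\<lambda>i j. \<Sum>t\<in>S. mmul n A (P t) i j)"
  unfolding mmul_def sum_distrib_left by (intro ext sum.swap)

lemma mmul_scale_left: "mmul n (\<lambda>i j. c * P i j) B = (\<lambda>i j. c * mmul n P B i j)"
  by (simp add: mmul_def sum_distrib_left mult.assoc)

lemma mmul_scale_right: "mmul n A (\<lambda>i j. c * P i j) = (\<lambda>i j. c * mmul n A P i j)"
  by (simp add: mmul_def sum_distrib_left mult.left_commute)

lemma mmul_uminus_left: "mmul n (\<lambda>i j. - P i j) B = (\<lambda>i j. - mmul n P B i j)"
  by (simp add: mmul_def sum_negf)

lemma mmul_uminus_right: "mmul n A (\<lambda>i j. - P i j) = (\<lambda>i j. - mmul n A P i j)"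
  by (simp add: mmul_def sum_negf)

lemma mtr_sum: "mtr n (\<lambda>i j. \<Sum>t\<in>S. P t i j) = (\<Sum>t\<in>S. mtr n (P t))"
  unfolding mtr_def by (rule sum.swap)

lemma mtr_scale: "mtr n (\<lambda>i j. c * P i j) = c * mtr n P"
  by (simp add: mtr_def sum_distrib_left)

lemma mtr_uminus: "mtr n (\<lambda>i j. - P i j) = - mtr n P"
  by (simp add: mtr_def sum_negf)

lemmas mlin = mmul_sum_left mmul_sum_right mmul_scale_left mmul_scale_right
  mmul_uminus_left mmul_uminus_right mtr_sum mtr_scale mtr_uminus

lemma mmul_inner_cong:
  assumes "\<And>i j. i < n \<Longrightarrow> j < n \<Longrightarrow> Z i j = Z' i j"
  shows "mmul n P (mmul n Z Q) = mmul n P (mmul n Z' Q)"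
  using assms by (auto intro!: ext mmul_cong)

lemma mtr_mmul_inner_cong:
  assumes "\<And>i j. i < n \<Longrightarrow> j < n \<Longrightarrow> Z i j = Z' i j"
  shows "mtr n (mmul n Z Q) = mtr n (mmul n Z' Q)"
  using assms by (auto intro!: mtr_cong mmul_cong)

section \<open>Words in matrices and sums over words\<close>

primrec mword :: "nat \<Rightarrow> (nat \<Rightarrow> nat \<Rightarrow> nat \<Rightarrow> 'b::comm_ring_1) \<Rightarrow> nat list \<Rightarrow> nat \<Rightarrow> nat \<Rightarrow> 'b" where
  "mword n a [] = mid"
| "mword n a (t # w) = mmul n (a t) (mword n a w)"

lemma mword_append: "i < n \<Longrightarrow> mword n a (u @ v) i j = mmul n (mword n a u) (mword n a v) i j"
proof (induction u arbitrary: i)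
  case (Cons t u)
  have "mword n a ((t # u) @ v) i j = mmul n (a t) (mmul n (mword n a u) (mword n a v)) i j"
    using Cons by (auto intro!: mmul_cong)
  then show ?case by (simp add: mmul_assoc)
qed (simp add: mmul_mid_left)

lemma mmul_mword_append: "mmul n P (mword n a (u @ v)) = mmul n P (mmul n (mword n a u) (mword n a v))"
  by (intro ext mmul_cong refl mword_append)

lemma mtr_mword_append: "mtr n (mword n a (u @ v)) = mtr n (mmul n (mword n a u) (mword n a v))"
  by (intro mtr_cong mword_append)

definition words :: "'l set \<Rightarrow> nat \<Rightarrow> 'l list set" where
  "words L m = {w. set w \<subseteq> L \<and> length w = m}"

lemma finite_words: "finite L \<Longrightarrow> finite (words L m)"
  unfolding words_def by (rule finite_lists_length_eq)

lemma words_0 [simp]: "words L 0 = {[]}"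
  by (auto simp: words_def)

lemma sum_words_Suc: "(\<Sum>w\<in>words L (Suc m). f w) = (\<Sum>t\<in>L. \<Sum>w\<in>words L m. f (t # w))"
proof -
  have "(\<Sum>t\<in>L. \<Sum>w\<in>words L m. f (t # w)) = (\<Sum>(t,w)\<in>L \<times> words L m. f (t # w))"
    by (simp add: sum.cartesian_product)
  also have "\<dots> = (\<Sum>w\<in>words L (Suc m). f w)"
    by (rule sum.reindex_bij_witness[where i = "\<lambda>w. (hd w, tl w)" and j = "\<lambda>(t,w). t # w"])
      (auto simp: words_def length_Suc_conv)
  finally show ?thesis by simp
qed

lemma sum_words_Suc': "(\<Sum>w\<in>words L (Suc m). f w) = (\<Sum>t\<in>L. \<Sum>w\<in>words L m. f (w @ [t]))"
proof -
  have "(\<Sum>t\<in>L. \<Sum>w\<in>words L m. f (w @ [t])) = (\<Sum>(t,w)\<in>L \<times> words L m. f (w @ [t]))"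
    by (simp add: sum.cartesian_product)
  also have "\<dots> = (\<Sum>w\<in>words L (Suc m). f w)"
    by (rule sum.reindex_bij_witness[where i = "\<lambda>w. (last w, butlast w)" and j = "\<lambda>(t,w). w @ [t]"])
      (auto simp: words_def length_Suc_conv_rev)
  finally show ?thesis by simp
qed

text \<open>If \<open>\<theta> t s = e\<^sub>t e\<^sub>s\<close>, this is the product of the \<open>e\<^sub>t\<close> along a word of even length; a single leftover letter is
  ignored, so words of odd length get a junk value.\<close>

fun pairing_word :: "(nat \<Rightarrow> nat \<Rightarrow> 'b::comm_ring_1) \<Rightarrow> nat list \<Rightarrow> 'b" where
  "pairing_word \<theta> (t # s # w) = \<theta> t s * pairing_word \<theta> w"
| "pairing_word \<theta> _ = 1"

lemma pairing_word_append:
  "even (length u) \<Longrightarrow> pairing_word \<theta> (u @ v) = pairing_word \<theta> u * pairing_word \<theta> v"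
  by (induction \<theta> u rule: pairing_word.induct) (auto simp: mult.assoc)

definition triples :: "nat \<Rightarrow> (nat \<times> nat \<times> nat) set" where
  "triples m = {(p, q, r). p + q + r = m}"

lemma finite_triples [simp]: "finite (triples m)"
  by (rule finite_subset[of _ "{..m} \<times> {..m} \<times> {..m}"]) (auto simp: triples_def)

lemma sum_triples: "(\<Sum>(p,q,r)\<in>triples m. f p q r) = (\<Sum>p\<le>m. \<Sum>q\<le>m - p. f p q (m - p - q))"
proof -
  have "(\<Sum>p\<le>m. \<Sum>q\<le>m - p. f p q (m - p - q)) = (\<Sum>(p,q)\<in>Sigma {..m} (\<lambda>p. {..m - p}). f p q (m - p - q))"
    by (simp add: sum.Sigma)
  also have "\<dots> = (\<Sum>(p,q,r)\<in>triples m. f p q r)"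
    by (rule sum.reindex_bij_witness[where i = "\<lambda>(p,q,r). (p,q)" and j = "\<lambda>(p,q). (p,q,m-p-q)"])
      (auto simp: triples_def)
  finally show ?thesis by simp
qed

text \<open>Exponents with an even sum are all even, or exactly two are odd. Two odd exponents use
  up 2 of the sum, so their halves add up to \<open>M\<close> instead of
  \<open>Suc M\<close>.\<close>

lemma sum_triples_parity:
  "(\<Sum>(p,q,r)\<in>triples (2 * Suc M). f p q r) = (\<Sum>(p,q,r)\<in>triples (Suc M). f (2*p) (2*q) (2*r))
     + (\<Sum>(p,q,r)\<in>triples M. f (2*p+1) (2*q+1) (2*r) + f (2*p+1) (2*q) (2*r+1) + f (2*p) (2*q+1) (2*r+1))"
proof -
  let ?g = "\<lambda>(p,q,r). f p q r"
  define e where "e a b c = (\<lambda>(p,q,r). (2*p+a, 2*q+b, 2*r+c))" for a b c :: nat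
  have inj: "inj_on (e a b c) A" for a b c A
    by (auto simp: inj_on_def e_def)
  have par: "x \<in> e 0 0 0 ` A \<Longrightarrow> even (fst x) \<and> even (fst (snd x))"
    "x \<in> e 1 1 0 ` A \<Longrightarrow> odd (fst x) \<and> odd (fst (snd x))"
    "x \<in> e 1 0 1 ` A \<Longrightarrow> odd (fst x) \<and> even (fst (snd x))"
    "x \<in> e 0 1 1 ` A \<Longrightarrow> even (fst x) \<and> odd (fst (snd x))" for x A
    by (auto simp: e_def)
  have *: "\<exists>k. x = 2 * k \<or> x = 2 * k + 1" for x :: nat
    by presburger
  have "triples (2 * Suc M) = e 0 0 0 ` triples (Suc M) \<union> e 1 1 0 ` triples M \<union> e 1 0 1 ` triples M \<union> e 0 1 1 ` triples M"
    (is "_ = ?R")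
  proof (intro equalityI subsetI)
    fix x assume "x \<in> triples (2 * Suc M)"
    moreover obtain p q r where x: "x = (p, q, r)" by (cases x)
    moreover obtain p' where "p = 2 * p' \<or> p = 2 * p' + 1" using * by blast
    moreover obtain q' where "q = 2 * q' \<or> q = 2 * q' + 1" using * by blast
    moreover obtain r' where "r = 2 * r' \<or> r = 2 * r' + 1" using * by blast
    ultimately have "x = e 0 0 0 (p',q',r') \<and> (p',q',r') \<in> triples (Suc M) \<or> x = e 1 1 0 (p',q',r') \<and> (p',q',r') \<in> triples M
       \<or> x = e 1 0 1 (p',q',r') \<and> (p',q',r') \<in> triples M \<or> x = e 0 1 1 (p',q',r') \<and> (p',q',r') \<in> triples M"
      by (elim disjE) (auto simp: triples_def e_def, presburger+)
    then show "x \<in> ?R" by blast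
  qed (auto simp: triples_def e_def)
  moreover have "e 0 0 0 ` A \<inter> e 1 1 0 ` B = {}" "e 0 0 0 ` A \<inter> e 1 0 1 ` B = {}" "e 0 0 0 ` A \<inter> e 0 1 1 ` B = {}"
    "e 1 1 0 ` A \<inter> e 1 0 1 ` B = {}" "e 1 1 0 ` A \<inter> e 0 1 1 ` B = {}" "e 1 0 1 ` A \<inter> e 0 1 1 ` B = {}" for A B
    unfolding disjoint_iff by (metis par)+
  ultimately have "sum ?g (triples (2 * Suc M)) = sum ?g (e 0 0 0 ` triples (Suc M)) + sum ?g (e 1 1 0 ` triples M)
     + sum ?g (e 1 0 1 ` triples M) + sum ?g (e 0 1 1 ` triples M)"
    by (simp only: sum.union_disjoint finite_UnI finite_imageI finite_triples Int_Un_distrib2 Un_empty simp_thms)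
  then show ?thesis
    unfolding sum.reindex[OF inj] by (simp add: o_def e_def case_prod_beta sum.distrib add.assoc)
qed


text \<open>The odd element \<open>X = \<Sum> e\<^sub>t a\<^sub>t\<close> itself does not live over a commutative ring, so only its even shadows occur:
  \<open>\<theta> t s\<close> is \<open>e\<^sub>t e\<^sub>s\<close>, \<open>X t\<close> is \<open>e\<^sub>t X\<close>, \<open>T\<close> is \<open>X\<^sup>2\<close> and \<open>\<phi> A\<close> is \<open>- X A X\<close>.\<close>

locale anticommuting_combination =
  fixes n :: nat and L :: "nat set" and a :: "nat \<Rightarrow> nat \<Rightarrow> nat \<Rightarrow> 'b::comm_ring_1" and \<theta> :: "nat \<Rightarrow> nat \<Rightarrow> 'b"
  assumes torsion_free': "\<And>m (x::'b). of_nat (Suc m) * x = 0 \<Longrightarrow> x = 0"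
    and anti: "\<theta> s t = - \<theta> t s"
    and exch: "\<theta> t s * \<theta> r u = \<theta> t u * \<theta> s r"
begin

definition X :: "nat \<Rightarrow> nat \<Rightarrow> nat \<Rightarrow> 'b" where
  "X t = (\<lambda>i j. \<Sum>s\<in>L. \<theta> t s * a s i j)"

definition T :: "nat \<Rightarrow> nat \<Rightarrow> 'b" where
  "T = (\<lambda>i j. \<Sum>t\<in>L. \<Sum>s\<in>L. \<theta> t s * mmul n (a t) (a s) i j)"

definition \<phi> :: "(nat \<Rightarrow> nat \<Rightarrow> 'b) \<Rightarrow> nat \<Rightarrow> nat \<Rightarrow> 'b" where
  "\<phi> A = (\<lambda>i j. - (\<Sum>t\<in>L. \<Sum>s\<in>L. \<theta> t s * mmul n (a t) (mmul n A (a s)) i j))"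

lemma T_eq: "T = (\<lambda>i j. \<Sum>t\<in>L. mmul n (a t) (X t) i j)"
  by (simp add: T_def X_def mlin)

text \<open>X commutes with its square. In coefficients this is \<open>exch\<close>, which says that
  e_u may pass the two odd factors e_s e_r.\<close>

lemma X_T: "mmul n (X t) T = mmul n T (X t)"
proof (intro ext)
  fix i j
  let ?m = "\<lambda>s r u. mmul n (a s) (mmul n (a r) (a u)) i j"
  have "mmul n (X t) T i j = (\<Sum>s\<in>L. \<Sum>r\<in>L. \<Sum>u\<in>L. \<theta> t s * \<theta> r u * ?m s r u)"
    unfolding X_def T_def mlin by (simp add: sum_distrib_left mult.assoc)
  also have "\<dots> = (\<Sum>s\<in>L. \<Sum>r\<in>L. \<Sum>u\<in>L. \<theta> t u * \<theta> s r * ?m s r u)"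
    by (intro sum.cong refl) (subst exch, rule refl)
  also have "\<dots> = mmul n T (X t) i j"
    unfolding X_def T_def mlin by (simp add: sum_distrib_left mult.left_commute mult.assoc mmul_assoc)
  finally show "mmul n (X t) T i j = mmul n T (X t) i j" .
qed

lemma X_mpow:
  "i < n \<Longrightarrow> j < n \<Longrightarrow> mmul n (X t) (mpow n T m) i j = mmul n (mpow n T m) (X t) i j"
proof (induction m arbitrary: i j)
  case 0
  then show ?case by (simp add: mmul_mid_left mmul_mid_right)
next
  case (Suc m)
  have "mmul n (X t) (mpow n T (Suc m)) i j = mmul n T (mmul n (X t) (mpow n T m)) i j"
    by (simp add: mmul_assoc[symmetric] X_T)
  also have "\<dots> = mmul n T (mmul n (mpow n T m) (X t)) i j"
    by (rule mmul_cong) (use Suc in auto)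
  finally show ?case by (simp add: mmul_assoc)
qed

lemma X_mpow_inner: "mmul n P (mmul n (X t) (mmul n (mpow n T m) Q)) = mmul n P (mmul n (mpow n T m) (mmul n (X t) Q))"
  using mmul_inner_cong[of n "mmul n (X t) (mpow n T m)" "mmul n (mpow n T m) (X t)" P Q] X_mpow
  by (simp add: mmul_assoc)

lemma X_mpow_tr: "mtr n (mmul n (X t) (mmul n (mpow n T m) Q)) = mtr n (mmul n (mpow n T m) (mmul n (X t) Q))"
  using mtr_mmul_inner_cong[of n "mmul n (X t) (mpow n T m)" "mmul n (mpow n T m) (X t)" Q] X_mpow
  by (simp add: mmul_assoc)

lemma X_mpow_tr_end: "mtr n (mmul n P (mmul n (X t) (mpow n T m))) = mtr n (mmul n P (mmul n (mpow n T m) (X t)))"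
  by (intro mtr_cong mmul_cong X_mpow refl)

lemma mmul_T: "mmul n T Q = (\<lambda>i j. \<Sum>t\<in>L. \<Sum>s\<in>L. \<theta> t s * mmul n (a t) (mmul n (a s) Q) i j)"
  by (simp add: T_def mlin mmul_assoc)

lemma mmul_T_X: "mmul n T Q = (\<lambda>i j. \<Sum>t\<in>L. mmul n (a t) (mmul n (X t) Q) i j)"
  by (simp add: T_eq mlin mmul_assoc)

text \<open>Carrying the last factor of X^(2m+2) around the trace passes an odd number of odd
  factors, so the trace equals its own negative; 2 can be cancelled.\<close>

lemma mtr_mpow: "mtr n (mpow n T (Suc m)) = 0"
proof -
  let ?s = "\<Sum>t\<in>L. \<Sum>s\<in>L. \<theta> t s * mtr n (mmul n (a t) (mmul n (a s) (mpow n T m)))"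
  have "mtr n (mpow n T (Suc m)) = ?s"
    unfolding mpow.simps mmul_T mlin ..
  have "mtr n (mpow n T (Suc m)) = (\<Sum>t\<in>L. mtr n (mmul n (a t) (mmul n (X t) (mpow n T m))))"
    unfolding mpow.simps mmul_T_X mlin ..
  also have "\<dots> = (\<Sum>t\<in>L. mtr n (mmul n (a t) (mmul n (mpow n T m) (X t))))"
    unfolding X_mpow_tr_end ..
  also have "\<dots> = (\<Sum>t\<in>L. mtr n (mmul n (X t) (mmul n (a t) (mpow n T m))))"
    unfolding mmul_assoc[symmetric] mtr_mmul_commute[of n _ "X _"] ..
  also have "\<dots> = (\<Sum>t\<in>L. \<Sum>s\<in>L. \<theta> t s * mtr n (mmul n (a s) (mmul n (a t) (mpow n T m))))"
    unfolding X_def mlin ..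
  also have "\<dots> = (\<Sum>t\<in>L. \<Sum>s\<in>L. \<theta> s t * mtr n (mmul n (a t) (mmul n (a s) (mpow n T m))))"
    by (rule sum.swap)
  also have "\<dots> = - ?s"
    unfolding sum_negf[symmetric] by (intro sum.cong refl) (subst anti, simp)
  finally have "mtr n (mpow n T (Suc m)) = - mtr n (mpow n T (Suc m))"
    using \<open>mtr n (mpow n T (Suc m)) = ?s\<close> by simp
  then have "of_nat (Suc 1) * mtr n (mpow n T (Suc m)) = 0"
    by (simp add: eq_neg_iff_add_eq_0 algebra_simps)
  then show ?thesis by (rule torsion_free')
qed

sublocale traceless_powers n T
  by unfold_locales (rule torsion_free', assumption, rule mtr_mpow)

text \<open>The trailing X of -XAX goes around the trace, and the sign from \<open>anti\<close>
  cancels the minus. So \<open>\<phi> A\<close> may serve as the primed letter of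
  \<open>t_shift\<close>.\<close>

lemma mtr_mpow_\<phi>: "mtr n (mmul n (mpow n T m) (\<phi> A)) = mtr n (mmul n (mpow n T (Suc m)) A)"
proof -
  let ?P = "mpow n T m"
  have "mtr n (mmul n ?P (\<phi> A)) = - (\<Sum>t\<in>L. mtr n (mmul n ?P (mmul n (a t) (mmul n A (X t)))))"
    unfolding \<phi>_def X_def mlin by (simp add: mlin)
  also have "\<dots> = - (\<Sum>t\<in>L. mtr n (mmul n (X t) (mmul n ?P (mmul n (a t) A))))"
    unfolding mmul_assoc[symmetric] mtr_mmul_commute[of n _ "X _"] ..
  also have "\<dots> = - (\<Sum>t\<in>L. mtr n (mmul n ?P (mmul n (X t) (mmul n (a t) A))))"
    unfolding X_mpow_tr ..
  also have "\<dots> = - (\<Sum>t\<in>L. \<Sum>s\<in>L. \<theta> t s * mtr n (mmul n ?P (mmul n (a s) (mmul n (a t) A))))"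
    unfolding X_def mlin ..
  also have "\<dots> = (\<Sum>t\<in>L. \<Sum>s\<in>L. \<theta> s t * mtr n (mmul n ?P (mmul n (a s) (mmul n (a t) A))))"
    unfolding sum_negf[symmetric] by (intro sum.cong refl) (subst anti, simp)
  also have "\<dots> = (\<Sum>s\<in>L. \<Sum>t\<in>L. \<theta> s t * mtr n (mmul n ?P (mmul n (a s) (mmul n (a t) A))))"
    by (rule sum.swap)
  also have "\<dots> = mtr n (mmul n ?P (mmul n T A))"
    unfolding mmul_T mlin ..
  also have "\<dots> = mtr n (mmul n (mpow n T (Suc m)) A)"
    unfolding mmul_assoc[symmetric] by (rule mtr_mmul_inner_cong) (rule mpow_commute)
  finally show ?thesis .
qed

text \<open>Both sides reduce to the trace of T^p X A T^q X B: on the left X slides through T^q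
  without a sign, on the right it goes around the trace and changes sign. Summation over p gives the
  cancellation of the \<open>\<tau>\<^sub>2\<close> terms.\<close>

lemma mtr_mpow_\<phi>_mpow:
  "mtr n (mmul n (mpow n T p) (mmul n (\<phi> A) (mmul n (mpow n T q) B)))
    = - mtr n (mmul n (mpow n T p) (mmul n A (mmul n (mpow n T q) (\<phi> B))))"
proof -
  let ?P = "mpow n T p" and ?Q = "mpow n T q"
  let ?Y = "\<Sum>t\<in>L. \<Sum>s\<in>L. \<theta> t s * mtr n (mmul n ?P (mmul n (a t) (mmul n A (mmul n ?Q (mmul n (a s) B)))))"
  have "mtr n (mmul n ?P (mmul n (\<phi> A) (mmul n ?Q B)))
     = - (\<Sum>t\<in>L. mtr n (mmul n ?P (mmul n (a t) (mmul n A (mmul n (X t) (mmul n ?Q B))))))"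
    unfolding \<phi>_def X_def mlin by (simp add: mlin mmul_assoc)
  also have "\<dots> = - (\<Sum>t\<in>L. mtr n (mmul n ?P (mmul n (a t) (mmul n A (mmul n ?Q (mmul n (X t) B))))))"
    unfolding X_mpow_inner ..
  also have "\<dots> = - ?Y"
    unfolding X_def mlin ..
  finally have 1: "mtr n (mmul n ?P (mmul n (\<phi> A) (mmul n ?Q B))) = - ?Y" .
  have "mtr n (mmul n ?P (mmul n A (mmul n ?Q (\<phi> B))))
     = - (\<Sum>t\<in>L. mtr n (mmul n ?P (mmul n A (mmul n ?Q (mmul n (a t) (mmul n B (X t)))))))"
    unfolding \<phi>_def X_def mlin by (simp add: mlin)
  also have "\<dots> = - (\<Sum>t\<in>L. mtr n (mmul n (X t) (mmul n ?P (mmul n A (mmul n ?Q (mmul n (a t) B))))))"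
    unfolding mmul_assoc[symmetric] mtr_mmul_commute[of n _ "X _"] ..
  also have "\<dots> = - (\<Sum>t\<in>L. mtr n (mmul n ?P (mmul n (X t) (mmul n A (mmul n ?Q (mmul n (a t) B))))))"
    unfolding X_mpow_tr ..
  also have "\<dots> = - (\<Sum>t\<in>L. \<Sum>s\<in>L. \<theta> t s * mtr n (mmul n ?P (mmul n (a s) (mmul n A (mmul n ?Q (mmul n (a t) B))))))"
    unfolding X_def mlin ..
  also have "\<dots> = (\<Sum>t\<in>L. \<Sum>s\<in>L. \<theta> s t * mtr n (mmul n ?P (mmul n (a s) (mmul n A (mmul n ?Q (mmul n (a t) B))))))"
    unfolding sum_negf[symmetric] by (intro sum.cong refl) (subst anti, simp)
  also have "\<dots> = ?Y"
    by (rule sum.swap)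
  finally show ?thesis using 1 by simp
qed

section \<open>Powers of X as sums over words\<close>

abbreviation "W \<equiv> pairing_word \<theta>"

text \<open>An even product is central, so the outer letters can be brought together; one use of
  \<open>exch\<close> passes each inner pair.\<close>

lemma W_outer_pair: "even (length u) \<Longrightarrow> W (t # u @ [s]) = \<theta> t s * W u"
proof (induction u arbitrary: t rule: induct_list012)
  case (3 x y w)
  then have "W (t # (x # y # w) @ [s]) = (\<theta> t x * \<theta> y s) * W w"
    by (simp add: mult.assoc)
  then show ?case by (subst (asm) exch) (simp add: mult.assoc)
qed auto

lemma mpow_eq_sum_words: "mpow n T m = (\<lambda>i j. \<Sum>w\<in>words L (2 * m). W w * mword n a w i j)"
proof (induction m)
  case (Suc m)
  show ?case
    unfolding mpow.simps Suc mmul_T mlin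
    by (simp add: sum_words_Suc sum_distrib_left mult.assoc mult.left_commute sum.swap[of _ "words L _" L])
qed simp

definition V :: "(nat \<Rightarrow> nat \<Rightarrow> 'b) \<Rightarrow> (nat \<Rightarrow> nat \<Rightarrow> 'b) \<Rightarrow> (nat \<Rightarrow> nat \<Rightarrow> 'b) \<Rightarrow> (nat \<Rightarrow> nat \<Rightarrow> 'b) \<Rightarrow> (nat \<Rightarrow> nat \<Rightarrow> 'b) \<Rightarrow> (nat \<Rightarrow> nat \<Rightarrow> 'b) \<Rightarrow> 'b" where
  "V P Q R A B C = mtr n (mmul n P (mmul n A (mmul n Q (mmul n B (mmul n R C)))))"

text \<open>This is the trace of X^p A X^q B X^r C written out over words. It is meant for even p +
  q + r, where \<open>W\<close> is the true product of the e_t.\<close>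

definition S :: "nat \<Rightarrow> nat \<Rightarrow> nat \<Rightarrow> (nat \<Rightarrow> nat \<Rightarrow> 'b) \<Rightarrow> (nat \<Rightarrow> nat \<Rightarrow> 'b) \<Rightarrow> (nat \<Rightarrow> nat \<Rightarrow> 'b) \<Rightarrow> 'b" where
  "S p q r A B C = (\<Sum>w1\<in>words L p. \<Sum>w2\<in>words L q. \<Sum>w3\<in>words L r.
     W (w1 @ w2 @ w3) * V (mword n a w1) (mword n a w2) (mword n a w3) A B C)"

lemma V_cong:
  assumes "\<And>i j. i < n \<Longrightarrow> j < n \<Longrightarrow> P i j = P' i j" "\<And>i j. i < n \<Longrightarrow> j < n \<Longrightarrow> Q i j = Q' i j"
    "\<And>i j. i < n \<Longrightarrow> j < n \<Longrightarrow> R i j = R' i j"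
  shows "V P Q R A B C = V P' Q' R' A B C"
proof -
  have "V P Q R A B C = mtr n (mmul n P' (mmul n A (mmul n Q (mmul n B (mmul n R C)))))"
    unfolding V_def using assms(1) by (rule mtr_mmul_inner_cong)
  also have "mmul n A (mmul n Q (mmul n B (mmul n R C))) = mmul n A (mmul n Q' (mmul n B (mmul n R C)))"
    using assms(2) by (rule mmul_inner_cong)
  also have "mmul n B (mmul n R C) = mmul n B (mmul n R' C)"
    using assms(3) by (rule mmul_inner_cong)
  finally show ?thesis by (simp add: V_def)
qed

lemma words_even: "w \<in> words L (2 * m) \<Longrightarrow> even (length w)"
  by (auto simp: words_def)

lemma S_even:
  "S (2*p) (2*q) (2*r) A B C = V (mpow n T p) (mpow n T q) (mpow n T r) A B C"
proof -
  have "V (mpow n T p) (mpow n T q) (mpow n T r) A B C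
     = (\<Sum>w1\<in>words L (2*p). \<Sum>w2\<in>words L (2*q). \<Sum>w3\<in>words L (2*r).
        W w1 * (W w2 * (W w3 * V (mword n a w1) (mword n a w2) (mword n a w3) A B C)))"
    unfolding V_def mpow_eq_sum_words mlin by (simp add: sum_distrib_left)
  also have "\<dots> = S (2*p) (2*q) (2*r) A B C"
    unfolding S_def
    by (intro sum.cong refl) (simp add: pairing_word_append words_even ac_simps)
  finally show ?thesis ..
qed

text \<open>The surplus factors at the end of the first power and the start of the second enclose
  \<open>A\<close>, and X A X is the negative of \<open>\<phi> A\<close>.\<close>

lemma S_odd_odd_even:
  "S (2*p+1) (2*q+1) (2*r) A B C = - V (mpow n T p) (mpow n T q) (mpow n T r) (\<phi> A) B C"
proof -
  have "S (2*p+1) (2*q+1) (2*r) A B C = (\<Sum>t\<in>L. \<Sum>s\<in>L. \<Sum>w1\<in>words L (2*p). \<Sum>w2\<in>words L (2*q). \<Sum>w3\<in>words L (2*r).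
     W ((w1 @ [t]) @ (s # w2) @ w3) * V (mword n a (w1 @ [t])) (mword n a (s # w2)) (mword n a w3) A B C)"
    unfolding S_def Suc_eq_plus1[symmetric]
    unfolding sum_words_Suc'[where m = "2*p"] sum_words_Suc[where m = "2*q"]
    unfolding sum.swap[of _ "words L _" L] ..
  also have "\<dots> = (\<Sum>t\<in>L. \<Sum>s\<in>L. \<theta> t s * (\<Sum>w1\<in>words L (2*p). \<Sum>w2\<in>words L (2*q). \<Sum>w3\<in>words L (2*r).
     W (w1 @ w2 @ w3) * V (mword n a w1) (mword n a w2) (mword n a w3) (mmul n (a t) (mmul n A (a s))) B C))"
    unfolding sum_distrib_left
  proof (intro sum.cong refl, goal_cases)
    case (1 t s w1 w2 w3)
    have "V (mword n a (w1 @ [t])) (mword n a (s # w2)) (mword n a w3) A B C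
      = V (mmul n (mword n a w1) (mword n a [t])) (mword n a (s # w2)) (mword n a w3) A B C"
      by (rule V_cong) (rule mword_append | simp)+
    then show ?case
      using 1 by (simp add: V_def mmul_assoc pairing_word_append words_even ac_simps)
  qed
  also have "\<dots> = (\<Sum>t\<in>L. \<Sum>s\<in>L. \<theta> t s * V (mpow n T p) (mpow n T q) (mpow n T r) (mmul n (a t) (mmul n A (a s))) B C)"
    by (simp add: S_even S_def[symmetric])
  also have "\<dots> = - V (mpow n T p) (mpow n T q) (mpow n T r) (\<phi> A) B C"
    by (simp add: V_def \<phi>_def mlin)
  finally show ?thesis .
qed

lemma S_even_odd_odd:
  "S (2*p) (2*q+1) (2*r+1) A B C = - V (mpow n T p) (mpow n T q) (mpow n T r) A (\<phi> B) C"
proof -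
  have "S (2*p) (2*q+1) (2*r+1) A B C = (\<Sum>t\<in>L. \<Sum>s\<in>L. \<Sum>w1\<in>words L (2*p). \<Sum>w2\<in>words L (2*q). \<Sum>w3\<in>words L (2*r).
     W (w1 @ (w2 @ [t]) @ (s # w3)) * V (mword n a w1) (mword n a (w2 @ [t])) (mword n a (s # w3)) A B C)"
    unfolding S_def Suc_eq_plus1[symmetric]
    unfolding sum_words_Suc'[where m = "2*q"] sum_words_Suc[where m = "2*r"]
    unfolding sum.swap[of _ "words L _" L] ..
  also have "\<dots> = (\<Sum>t\<in>L. \<Sum>s\<in>L. \<theta> t s * (\<Sum>w1\<in>words L (2*p). \<Sum>w2\<in>words L (2*q). \<Sum>w3\<in>words L (2*r).
     W (w1 @ w2 @ w3) * V (mword n a w1) (mword n a w2) (mword n a w3) A (mmul n (a t) (mmul n B (a s))) C))"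
    unfolding sum_distrib_left
  proof (intro sum.cong refl, goal_cases)
    case (1 t s w1 w2 w3)
    have "V (mword n a w1) (mword n a (w2 @ [t])) (mword n a (s # w3)) A B C
      = V (mword n a w1) (mmul n (mword n a w2) (mword n a [t])) (mword n a (s # w3)) A B C"
      by (rule V_cong) (rule mword_append | simp)+
    then show ?case
      using 1 by (simp add: V_def mmul_assoc pairing_word_append words_even ac_simps)
  qed
  also have "\<dots> = (\<Sum>t\<in>L. \<Sum>s\<in>L. \<theta> t s * V (mpow n T p) (mpow n T q) (mpow n T r) A (mmul n (a t) (mmul n B (a s))) C)"
    by (simp add: S_even S_def[symmetric])
  also have "\<dots> = - V (mpow n T p) (mpow n T q) (mpow n T r) A (\<phi> B) C"
    by (simp add: V_def \<phi>_def mlin)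
  finally show ?thesis .
qed

text \<open>The surplus factors stand at the far ends and enclose \<open>C\<close> only after one
  has gone around the trace. That changes the sign, unlike in the other two mixed cases.\<close>

lemma S_odd_even_odd:
  "S (2*p+1) (2*q) (2*r+1) A B C = V (mpow n T p) (mpow n T q) (mpow n T r) A B (\<phi> C)"
proof -
  have "S (2*p+1) (2*q) (2*r+1) A B C = (\<Sum>t\<in>L. \<Sum>s\<in>L. \<Sum>w1\<in>words L (2*p). \<Sum>w2\<in>words L (2*q). \<Sum>w3\<in>words L (2*r).
     W ((t # w1) @ w2 @ (w3 @ [s])) * V (mword n a (t # w1)) (mword n a w2) (mword n a (w3 @ [s])) A B C)"
    unfolding S_def Suc_eq_plus1[symmetric]
    unfolding sum_words_Suc'[where m = "2*r"] sum_words_Suc[where m = "2*p"]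
    unfolding sum.swap[of _ "words L _" L] ..
  also have "\<dots> = (\<Sum>t\<in>L. \<Sum>s\<in>L. \<theta> t s * (\<Sum>w1\<in>words L (2*p). \<Sum>w2\<in>words L (2*q). \<Sum>w3\<in>words L (2*r).
     W (w1 @ w2 @ w3) * V (mword n a w1) (mword n a w2) (mword n a w3) A B (mmul n (a s) (mmul n C (a t)))))"
    unfolding sum_distrib_left
  proof (intro sum.cong refl, goal_cases)
    case (1 t s w1 w2 w3)
    have "V (mword n a (t # w1)) (mword n a w2) (mword n a (w3 @ [s])) A B C
      = V (mword n a (t # w1)) (mword n a w2) (mmul n (mword n a w3) (mword n a [s])) A B C"
      by (rule V_cong) (rule mword_append | simp)+
    also have "\<dots> = V (mword n a w1) (mword n a w2) (mword n a w3) A B (mmul n (a s) (mmul n C (a t)))"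
      unfolding V_def mword.simps mmul_assoc[of n "a t"]
      by (subst mtr_mmul_commute) (simp add: mmul_assoc)
    finally show ?case
      using 1 W_outer_pair[of "w1 @ w2 @ w3" t s] by (simp add: words_even)
  qed
  also have "\<dots> = (\<Sum>t\<in>L. \<Sum>s\<in>L. \<theta> t s * V (mpow n T p) (mpow n T q) (mpow n T r) A B (mmul n (a s) (mmul n C (a t))))"
    by (simp add: S_even S_def[symmetric])
  also have "\<dots> = - (\<Sum>t\<in>L. \<Sum>s\<in>L. \<theta> s t * V (mpow n T p) (mpow n T q) (mpow n T r) A B (mmul n (a s) (mmul n C (a t))))"
    unfolding sum_negf[symmetric] by (intro sum.cong refl) (subst anti, simp)
  also have "\<dots> = - (\<Sum>s\<in>L. \<Sum>t\<in>L. \<theta> s t * V (mpow n T p) (mpow n T q) (mpow n T r) A B (mmul n (a s) (mmul n C (a t))))"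
    by (subst sum.swap) (rule refl)
  also have "\<dots> = V (mpow n T p) (mpow n T q) (mpow n T r) A B (\<phi> C)"
    by (simp add: V_def \<phi>_def mlin)
  finally show ?thesis .
qed

lemma tr3_nth: "tr3 n (mgen n T) (mconst A) (mconst B) (mconst C) $ m
    = (\<Sum>(p,q,r)\<in>triples m. V (mpow n T p) (mpow n T q) (mpow n T r) A B C)"
  unfolding sum_triples tr3_def V_def
  by (simp add: mtr_def fps_sum_nth fps_nth_mmul[of n "mgen n T"] fps_nth_mmul_mconst_left
      fps_nth_mmul_mconst_right mlin sum.swap[of _ "{..<n}"])

lemma tr2_nth: "tr2 n (mgen n T) (mconst A) (mconst B) $ m
    = (\<Sum>p\<le>m. mtr n (mmul n (mpow n T p) (mmul n A (mmul n (mpow n T (m - p)) B))))"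
  unfolding tr2_def
  by (simp add: mtr_def fps_sum_nth fps_nth_mmul[of n "mgen n T"] fps_nth_mmul_mconst_left
      fps_nth_mmul_mconst_right mlin sum.swap[of _ "{..<n}"])

text \<open>The weight (-1)^q gives the three mixed parity cases the same sign, so the sum is the
  coefficient of u^(2n-2) that vanishes by \<open>cyc_total_nth_eq_0\<close>. The degree 4n - 4
  counts factors X, and u stands for two of them.\<close>

theorem sum_triples_S_eq_0:
  assumes n: "n \<ge> 2"
  shows "(\<Sum>(p,q,r)\<in>triples (4 * n - 4). (-1) ^ q * (S p q r A B C + S p q r B A C)) = 0"
proof -
  define M where "M = 2 * n - 3"
  have M: "4 * n - 4 = 2 * Suc M" "2 * n - 2 = Suc M" using n by (auto simp: M_def)
  have shift: "fps_X * \<tau>\<^sub>1 (\<phi> A) = \<tau>\<^sub>1 A - fps_const (mtr n A)" for A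
    by (rule t_shift) (rule mtr_mpow_\<phi>)
  have tau: "\<tau>\<^sub>2 (\<phi> A) B + \<tau>\<^sub>2 A (\<phi> B) = 0" for A B
    by (rule fps_ext) (simp add: tr2_nth mtr_mpow_\<phi>_mpow sum_negf)
  have "(cyc A B C + fps_X * (cyc (\<phi> A) B C + cyc A (\<phi> B) C + cyc A B (\<phi> C))) $ (2 * n - 2) = 0"
    by (rule cyc_total_nth_eq_0) (use n in \<open>simp_all add: shift tau\<close>)
  moreover have cyc: "cyc A B C $ m = (\<Sum>(p,q,r)\<in>triples m.
      V (mpow n T p) (mpow n T q) (mpow n T r) A B C + V (mpow n T p) (mpow n T q) (mpow n T r) B A C)" for A B C m
    by (simp add: cyc3_def tr3_rotate[of n _ "mconst A" "mconst C"] tr3_rotate[of n _ "mconst C" "mconst B"]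
        tr3_nth sum.distrib case_prod_beta)
  ultimately show ?thesis
    unfolding M sum_triples_parity S_even S_odd_odd_even S_even_odd_odd S_odd_even_odd
    by (simp add: sum.distrib case_prod_beta sum_subtractf sum_negf algebra_simps)
qed

end

section \<open>The even part of the Grassmann algebra\<close>

lemma finite_inversions: "finite A \<Longrightarrow> finite B \<Longrightarrow> finite {(a, b). a \<in> A \<and> b \<in> B \<and> b < (a::nat)}"
  by (rule finite_subset[of _ "A \<times> B"]) auto

lemma gsign_Un_left:
  assumes "finite A" "finite A'" "finite B" "A \<inter> A' = {}"
  shows "gsign (A \<union> A') B = gsign A B * gsign A' B"
proof -
  have "{(a, b). a \<in> A \<union> A' \<and> b \<in> B \<and> b < a}
     = {(a, b). a \<in> A \<and> b \<in> B \<and> b < a} \<union> {(a, b). a \<in> A' \<and> b \<in> B \<and> b < a}" by auto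
  moreover have "{(a, b). a \<in> A \<and> b \<in> B \<and> b < a} \<inter> {(a, b). a \<in> A' \<and> b \<in> B \<and> b < a} = {}"
    using assms by auto
  ultimately show ?thesis
    unfolding gsign_def using assms by (simp add: card_Un_disjoint finite_inversions power_add)
qed

lemma gsign_Un_right:
  assumes "finite A" "finite B" "finite B'" "B \<inter> B' = {}"
  shows "gsign A (B \<union> B') = gsign A B * gsign A B'"
proof -
  have "{(a, b). a \<in> A \<and> b \<in> B \<union> B' \<and> b < a}
     = {(a, b). a \<in> A \<and> b \<in> B \<and> b < a} \<union> {(a, b). a \<in> A \<and> b \<in> B' \<and> b < a}" by auto
  moreover have "{(a, b). a \<in> A \<and> b \<in> B \<and> b < a} \<inter> {(a, b). a \<in> A \<and> b \<in> B' \<and> b < a} = {}"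
    using assms by auto
  ultimately show ?thesis
    unfolding gsign_def using assms by (simp add: card_Un_disjoint finite_inversions power_add)
qed

lemma gsign_empty [simp]: "gsign {} B = 1" "gsign A {} = 1"
  by (simp_all add: gsign_def)

lemma gsign_square: "gsign A B * gsign A B = 1"
  by (simp add: gsign_def power_add[symmetric] mult_2[symmetric] power_mult)

text \<open>Each pair from disjoint sets is an inversion for exactly one of the two orders.\<close>

lemma gsign_swap:
  assumes "finite A" "finite B" "A \<inter> B = {}"
  shows "gsign B A = (-1) ^ (card A * card B) * (gsign A B :: 'a::comm_ring_1)"
proof -
  let ?I = "{(a, b). a \<in> A \<and> b \<in> B \<and> b < a}" and ?J = "{(b, a). b \<in> B \<and> a \<in> A \<and> a < b}"
  have "card ?J = card (prod.swap ` ?J)"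
    by (rule card_image[symmetric]) (auto simp: inj_on_def)
  also have "prod.swap ` ?J = {(a, b). a \<in> A \<and> b \<in> B \<and> a < b}" by auto
  finally have J: "card ?J = card {(a, b). a \<in> A \<and> b \<in> B \<and> a < b}" .
  have "?I \<union> {(a, b). a \<in> A \<and> b \<in> B \<and> a < b} = A \<times> B"
    using assms(3) by auto
  moreover have "finite {(a, b). a \<in> A \<and> b \<in> B \<and> a < b}"
    by (rule finite_subset[of _ "A \<times> B"]) (use assms in auto)
  moreover have "?I \<inter> {(a, b). a \<in> A \<and> b \<in> B \<and> a < b} = {}" by auto
  ultimately have "card ?I + card ?J = card (A \<times> B)"
    unfolding J using assms finite_inversions by (metis (no_types, lifting) card_Un_disjoint)
  then have "gsign A B * gsign B A = ((-1) ^ (card A * card B) :: 'a)"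
    by (simp add: gsign_def power_add[symmetric] card_cartesian_product)
  then have "gsign A B * gsign A B * gsign B A = gsign A B * ((-1) ^ (card A * card B) :: 'a)"
    by (simp add: mult.assoc)
  then show ?thesis by (simp add: gsign_square mult.commute)
qed

text \<open>Both sides run over the divisions of \<open>S\<close> into three disjoint pieces, and
  inversions are additive in either argument. On infinite sets all products are 0.\<close>

lemma gmult_assoc: "gmult (gmult x y) z = gmult x (gmult y z)"
proof
  fix S
  show "gmult (gmult x y) z S = gmult x (gmult y z) S"
  proof (cases "finite S")
    case True
    have fin: "finite A" if "A \<subseteq> S" for A using True that finite_subset by blast
    have "gmult (gmult x y) z S
      = (\<Sum>(A,B)\<in>Sigma (Pow S) Pow. gsign A (S - A) * (gsign B (A - B) * x B * y (A - B)) * z (S - A))"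
      using True fin by (simp add: gmult_def sum_distrib_left sum_distrib_right sum.Sigma)
    also have "\<dots> = (\<Sum>(B,C)\<in>Sigma (Pow S) (\<lambda>B. Pow (S - B)).
        gsign B (S - B) * x B * (gsign C (S - B - C) * y C * z (S - B - C)))"
    proof (rule sum.reindex_bij_witness[where i = "\<lambda>(B,C). (B \<union> C, B)" and j = "\<lambda>(A,B). (B, A - B)"])
      fix p assume p: "p \<in> Sigma (Pow S) Pow"
      obtain A B where AB: "p = (A, B)" "A \<subseteq> S" "B \<subseteq> A" using p by (cases p) auto
      have e: "S - B - (A - B) = S - A" "B \<union> (A - B) = A" "(A - B) \<union> (S - A) = S - B" using AB by auto
      have 1: "(gsign A (S - A) :: 'a) = gsign B (S - A) * gsign (A - B) (S - A)"
        using gsign_Un_left[of B "A - B" "S - A"] AB fin e True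
        by (metis Diff_disjoint Diff_subset finite_Diff order_trans)
      have 2: "(gsign B (S - B) :: 'a) = gsign B (A - B) * gsign B (S - A)"
        using gsign_Un_right[of B "A - B" "S - A"] AB fin e True
        by (metis Diff_disjoint Diff_subset Int_Diff Int_commute Int_empty_right finite_Diff order_trans)
      show "(case case p of (A, B) \<Rightarrow> (B, A - B) of (B, C) \<Rightarrow> gsign B (S - B) * x B * (gsign C (S - B - C) * y C * z (S - B - C)))
         = (case p of (A, B) \<Rightarrow> gsign A (S - A) * (gsign B (A - B) * x B * y (A - B)) * z (S - A))"
        unfolding AB(1) prod.case e 1 2 by (simp add: ac_simps)
    qed auto
    also have "\<dots> = gmult x (gmult y z) S"
      using True fin by (simp add: gmult_def sum_distrib_left sum.Sigma)
    finally show ?thesis .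
  qed (simp add: gmult_def)
qed

lemma gmult_commute:
  assumes "\<And>S. odd (card S) \<Longrightarrow> x S = 0"
  shows "gmult x y = gmult y x"
proof
  fix S
  show "gmult x y S = gmult y x S"
  proof (cases "finite S")
    case True
    have "gmult x y S = (\<Sum>A\<in>Pow S. gsign (S - A) A * x (S - A) * y A)"
      unfolding gmult_def
      by (rule sum.reindex_bij_witness[where i = "\<lambda>A. S - A" and j = "\<lambda>A. S - A"]) (auto simp: double_diff)
    also have "\<dots> = gmult y x S"
      unfolding gmult_def
    proof (intro sum.cong refl)
      fix A assume A: "A \<in> Pow S"
      then have fin: "finite A" "finite (S - A)" using True finite_subset by auto
      show "gsign (S - A) A * x (S - A) * y A = gsign A (S - A) * y A * x (S - A)"
      proof (cases "odd (card (S - A))")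
        case False
        then have "(gsign (S - A) A :: 'a) = gsign A (S - A)"
          using fin by (subst gsign_swap) auto
        then show ?thesis by (simp add: ac_simps)
      qed (simp add: assms)
    qed
    finally show ?thesis .
  qed (simp add: gmult_def)
qed

lemma gmult_gone_left: "(\<And>S. infinite S \<Longrightarrow> x S = 0) \<Longrightarrow> gmult gone x = x"
proof
  fix S assume inf: "\<And>S. infinite S \<Longrightarrow> x S = 0"
  have "gmult gone x S = (\<Sum>A\<in>Pow S. if A = {} then x S else 0)"
    unfolding gmult_def gone_def by (intro sum.cong refl) auto
  also have "\<dots> = x S"
    using inf by (cases "finite S") auto
  finally show "gmult gone x S = x S" .
qed

lemma gmult_add_right: "gmult x (\<lambda>S. y S + z S) = (\<lambda>S. gmult x y S + gmult x z S)"
  by (simp add: gmult_def sum.distrib algebra_simps)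

lemma gmult_nonzeroE:
  assumes "gmult x y S \<noteq> 0"
  obtains A B where "finite A" "finite B" "A \<inter> B = {}" "S = A \<union> B" "x A \<noteq> 0" "y B \<noteq> 0"
proof -
  have "finite S" using assms by (cases "finite S") (auto simp: gmult_def)
  obtain A where "A \<in> Pow S" "gsign A (S - A) * x A * y (S - A) \<noteq> 0"
    using assms unfolding gmult_def by (rule sum.not_neutral_contains_not_neutral)
  moreover have "S = A \<union> (S - A)" using \<open>A \<in> Pow S\<close> by auto
  ultimately show ?thesis using \<open>finite S\<close> that[of A "S - A"]
    by (metis Diff_disjoint PowD finite_Diff finite_subset mult_zero_left mult_zero_right)
qed

text \<open>Even elements commute, which makes determinants available. Infinite sets are excluded
  because \<open>gmult\<close> vanishes there, so \<open>gone\<close> would not be neutral.\<close>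

typedef (overloaded) 'a even_grass =
  "{x :: 'a::comm_ring_1 grass. \<forall>S. infinite S \<or> odd (card S) \<longrightarrow> x S = 0}"
  by (rule exI[of _ "\<lambda>_. 0"]) simp

setup_lifting type_definition_even_grass

lemma odd_card_Un_disjoint:
  "finite A \<Longrightarrow> finite B \<Longrightarrow> A \<inter> B = {} \<Longrightarrow> odd (card (A \<union> B)) \<Longrightarrow> odd (card A) \<or> odd (card B)"
  by (simp add: card_Un_disjoint)

instantiation even_grass :: (comm_ring_1) comm_ring_1
begin

lift_definition zero_even_grass :: "'a even_grass" is "\<lambda>_. 0" by simp
lift_definition one_even_grass :: "'a even_grass" is gone by (auto simp: gone_def)
lift_definition plus_even_grass :: "'a even_grass \<Rightarrow> 'a even_grass \<Rightarrow> 'a even_grass" is "\<lambda>x y S. x S + y S" by simp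
lift_definition minus_even_grass :: "'a even_grass \<Rightarrow> 'a even_grass \<Rightarrow> 'a even_grass" is "\<lambda>x y S. x S - y S" by simp
lift_definition uminus_even_grass :: "'a even_grass \<Rightarrow> 'a even_grass" is "\<lambda>x S. - x S" by simp
lift_definition times_even_grass :: "'a even_grass \<Rightarrow> 'a even_grass \<Rightarrow> 'a even_grass" is gmult
  by (metis gmult_nonzeroE finite_UnI odd_card_Un_disjoint)

instance
proof
  fix x y z :: "'a even_grass"
  show "x * y * z = x * (y * z)" by transfer (rule gmult_assoc)
  show com: "x * y = y * x" for x y :: "'a even_grass" by transfer (rule gmult_commute, simp)
  show "1 * x = x" by transfer (rule gmult_gone_left, simp)
  have dist: "x * (y + z) = x * y + x * z" by transfer (rule gmult_add_right)
  show "(x + y) * z = x * z + y * z" for x y z :: "'a even_grass"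
  proof -
    have "z * (x + y) = z * x + z * y" by transfer (rule gmult_add_right)
    then show ?thesis by (simp add: com)
  qed
  show "(0::'a even_grass) \<noteq> 1" by transfer (metis gone_def zero_neq_one)
qed (transfer, simp add: algebra_simps)+

end

lift_definition coeff_even :: "'a::comm_ring_1 even_grass \<Rightarrow> nat set \<Rightarrow> 'a" is "\<lambda>x. x" .

lemma coeff_even_add: "coeff_even (x + y) S = coeff_even x S + coeff_even y S"
  by transfer simp

lemma coeff_even_0 [simp]: "coeff_even 0 S = 0"
  by transfer simp

lemma coeff_even_uminus: "coeff_even (- x) S = - coeff_even x S"
  by transfer simp

lemma coeff_even_sum: "coeff_even (\<Sum>i\<in>I. f i) S = (\<Sum>i\<in>I. coeff_even (f i) S)"
  by (induction I rule: infinite_finite_induct) (simp_all add: coeff_even_add)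

lemma even_grass_eqI: "(\<And>S. coeff_even x S = coeff_even y S) \<Longrightarrow> x = y"
  by transfer auto

lemma coeff_even_of_nat_mult: "coeff_even (of_nat m * x) S = of_nat m * coeff_even x S"
  by (induction m) (simp_all add: coeff_even_add algebra_simps)

lift_definition scalar_even :: "'a::comm_ring_1 \<Rightarrow> 'a even_grass" is "\<lambda>c S. if S = {} then c else 0"
  by auto

lemma gmult_scalar_right:
  assumes "\<And>S. infinite S \<Longrightarrow> x S = 0"
  shows "gmult x (\<lambda>S. if S = {} then c else 0) = (\<lambda>S. x S * c)"
proof
  fix S
  have "gmult x (\<lambda>S. if S = {} then c else 0) S = (\<Sum>A\<in>Pow S. if A = S then x S * c else 0)"
    unfolding gmult_def by (intro sum.cong refl) auto
  also have "\<dots> = x S * c"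
    using assms by (cases "finite S") auto
  finally show "gmult x (\<lambda>S. if S = {} then c else 0) S = x S * c" .
qed

lemma coeff_even_mult_scalar: "coeff_even (x * scalar_even c) S = coeff_even x S * c"
  by transfer (simp add: gmult_scalar_right)

lemma scalar_even_1: "scalar_even 1 = 1"
  by transfer (simp add: gone_def)

lemma scalar_even_0: "scalar_even 0 = 0"
  by transfer auto

lemma scalar_even_add: "scalar_even (c + d) = scalar_even c + scalar_even d"
  by transfer auto

lemma scalar_even_mult: "scalar_even (c * d) = scalar_even c * scalar_even d"
  by transfer (subst gmult_scalar_right, auto)

lemma scalar_even_sum: "scalar_even (\<Sum>i\<in>I. f i) = (\<Sum>i\<in>I. scalar_even (f i))"
  by (induction I rule: infinite_finite_induct) (simp_all add: scalar_even_add scalar_even_0)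

section \<open>Signs of words and Grassmann monomials\<close>

primrec lsign :: "nat list \<Rightarrow> 'a::comm_ring_1" where
  "lsign [] = 1"
| "lsign (x # w) = gsign {x} (set w) * lsign w"

text \<open>For a word without repetition \<open>lsign\<close> is the parity of its inversions;
  those of a concatenation lie inside one part or between the two.\<close>

lemma lsign_append:
  "distinct (u @ v) \<Longrightarrow> lsign (u @ v) = lsign u * lsign v * gsign (set u) (set v)"
proof (induction u)
  case (Cons x u)
  have "(gsign {x} (set u \<union> set v) :: 'a) = gsign {x} (set u) * gsign {x} (set v)"
    using Cons.prems by (intro gsign_Un_right) auto
  moreover have "(gsign ({x} \<union> set u) (set v) :: 'a) = gsign {x} (set v) * gsign (set u) (set v)"
    using Cons.prems by (intro gsign_Un_left) auto
  ultimately show ?case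
    using Cons by (simp add: ac_simps)
qed simp

lemma lsign_square: "lsign w * lsign w = (1 :: 'a::comm_ring_1)"
proof (induction w)
  case (Cons x w)
  have "lsign (x # w) * lsign (x # w) = (gsign {x} (set w) * gsign {x} (set w)) * (lsign w * lsign w :: 'a)"
    by (simp add: ac_simps)
  then show ?case by (simp add: Cons gsign_square)
qed simp

lemma lsign_swap:
  assumes "distinct (xs @ x # y # ys)"
  shows "lsign (xs @ y # x # ys) = - (lsign (xs @ x # y # ys) :: 'a::comm_ring_1)"
proof -
  have 1: "(gsign {y} {x} :: 'a) = - gsign {x} {y}"
    using assms by (subst gsign_swap) auto
  have 2: "(gsign {a} (insert b (set ys)) :: 'a) = gsign {a} {b} * gsign {a} (set ys)" if "b \<notin> set ys" for a b
    using gsign_Un_right[of "{a}" "{b}" "set ys"] that by simp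
  show ?thesis
    using assms by (simp add: lsign_append insert_commute 2 1 ac_simps)
qed

lemma lsign_move:
  assumes "distinct (xs @ x # ys @ zs)"
  shows "lsign (xs @ x # ys @ zs) = (-1) ^ length ys * (lsign (xs @ ys @ x # zs) :: 'a::comm_ring_1)"
  using assms
proof (induction ys arbitrary: xs)
  case (Cons y ys)
  have "(lsign (xs @ x # y # ys @ zs) :: 'a) = - lsign ((xs @ [y]) @ x # ys @ zs)"
    using Cons.prems lsign_swap[of xs y x "ys @ zs"] by auto
  then show ?case
    using Cons.prems Cons.IH[of "xs @ [y]"] by auto
qed simp

text \<open>This is the product of the generators along the word, sorted into the standard
  basis.\<close>

definition gmono :: "nat list \<Rightarrow> 'a::comm_ring_1 grass" where
  "gmono w = (\<lambda>S. if distinct w \<and> S = set w then lsign w else 0)"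

lemma gmult_gmono: "gmult (gmono u) (gmono v) = gmono (u @ v)"
proof
  fix S
  show "gmult (gmono u) (gmono v) S = (gmono (u @ v) S :: 'a)"
  proof (cases "finite S")
    case True
    have "gmult (gmono u) (gmono v) S = (\<Sum>A\<in>Pow S. if A = set u then gmono (u @ v) S else (0::'a))"
      unfolding gmult_def
    proof (intro sum.cong refl)
      fix A assume A: "A \<in> Pow S"
      have *: "distinct (u @ v) \<and> S = set (u @ v) \<longleftrightarrow> distinct u \<and> distinct v \<and> S - set u = set v" if "set u \<subseteq> S"
        using that by auto
      show "gsign A (S - A) * gmono u A * gmono v (S - A) = (if A = set u then gmono (u @ v) S else (0::'a))"
      proof (cases "A = set u")
        case True
        then show ?thesis using * A by (auto simp: gmono_def lsign_append)
      qed (simp add: gmono_def)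
    qed
    also have "\<dots> = (if set u \<subseteq> S then gmono (u @ v) S else 0)"
      using True by simp
    also have "\<dots> = gmono (u @ v) S"
      by (auto simp: gmono_def)
    finally show ?thesis .
  qed (auto simp: gmult_def gmono_def)
qed

lemma gmono_swap: "gmono (xs @ y # x # ys) = (\<lambda>S. - gmono (xs @ x # y # ys) S)"
proof
  fix S
  have d: "distinct (xs @ y # x # ys) \<longleftrightarrow> distinct (xs @ x # y # ys)" by auto
  have s: "set (xs @ y # x # ys) = set (xs @ x # y # ys)" by auto
  show "gmono (xs @ y # x # ys) S = - (gmono (xs @ x # y # ys) S :: 'a)"
  proof (cases "distinct (xs @ x # y # ys) \<and> S = set (xs @ x # y # ys)")
    case True
    then show ?thesis
      unfolding gmono_def d s by (simp only: simp_thms if_True lsign_swap)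
  next
    case False
    then show ?thesis
      unfolding gmono_def d s by (simp only: if_False minus_zero)
  qed
qed

text \<open>Words of odd length get the default 0, as their monomials lie outside the even
  ring.\<close>

lift_definition emono :: "nat list \<Rightarrow> 'a::comm_ring_1 even_grass" is "\<lambda>w. if even (length w) then gmono w else (\<lambda>_. 0)"
  by (auto simp: gmono_def distinct_card)

lemma emono_append: "even (length u) \<Longrightarrow> even (length v) \<Longrightarrow> emono (u @ v) = emono u * emono v"
  by transfer (simp add: gmult_gmono)

lemma coeff_emono_eq_gmono: "even (length w) \<Longrightarrow> coeff_even (emono w) S = gmono w S"
  by transfer simp

lemma emono_swap:
  assumes "even (length xs + length ys)"
  shows "emono (xs @ y # x # ys) = - (emono (xs @ x # y # ys) :: 'a::comm_ring_1 even_grass)"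
proof (rule even_grass_eqI)
  fix S
  have "coeff_even (emono (xs @ y # x # ys)) S = (gmono (xs @ y # x # ys) S :: 'a)"
    by (rule coeff_emono_eq_gmono) (use assms in simp)
  also have "\<dots> = - gmono (xs @ x # y # ys) S"
    by (rule fun_cong[OF gmono_swap])
  also have "gmono (xs @ x # y # ys) S = (coeff_even (emono (xs @ x # y # ys)) S :: 'a)"
    by (rule coeff_emono_eq_gmono[symmetric]) (use assms in simp)
  finally show "coeff_even (emono (xs @ y # x # ys)) S = (coeff_even (- emono (xs @ x # y # ys)) S :: 'a)"
    by (simp only: coeff_even_uminus)
qed

lemma coeff_emono: "even (length w) \<Longrightarrow> coeff_even (emono w) S = (if distinct w \<and> S = set w then lsign w else 0)"
  by transfer (simp add: gmono_def)

lemma pairing_word_emono: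
  "even (length w) \<Longrightarrow> pairing_word (\<lambda>t s. emono [t, s]) w = (emono w :: 'a::comm_ring_1 even_grass)"
proof (induction w rule: induct_list012)
  case 1
  have "(emono [] :: 'a even_grass) = 1" by transfer (auto simp: gmono_def gone_def)
  then show ?case by simp
next
  case (3 x y w)
  then have "even (length w)" by simp
  then have "emono ([x, y] @ w) = emono [x, y] * (emono w :: 'a even_grass)"
    by (intro emono_append) simp_all
  then show ?case using 3 by (simp only: append.simps pairing_word.simps list.size) simp
qed simp

text \<open>The concrete model, with e_t the generator of index t. Positive integers are cancelled
  coefficientwise, by characteristic 0 and the absence of zero divisors.\<close>

lemma anticommuting_combination_emono:
  "anticommuting_combination (\<lambda>t s. emono [t, s] :: 'a::{comm_ring_1,ring_char_0,semiring_no_zero_divisors} even_grass)"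
proof
  fix m and x :: "'a even_grass"
  assume "of_nat (Suc m) * x = 0"
  then have "of_nat (Suc m) * coeff_even x S = 0" for S
    by (simp only: coeff_even_of_nat_mult[symmetric] coeff_even_0)
  then have "coeff_even x S = 0" for S
    by (simp only: mult_eq_0_iff of_nat_eq_0_iff) auto
  then show "x = 0" by (intro even_grass_eqI) simp
next
  have app: "emono [t, s] * emono [r, u] = (emono [t, s, r, u] :: 'a even_grass)" for t s r u
    using emono_append[of "[t, s]" "[r, u]", where 'a = 'a] by (simp only: append.simps list.size) simp
  show "emono [s, t] = - (emono [t, s] :: 'a even_grass)" for s t
    using emono_swap[of "[]" "[]" s t, where 'a = 'a] by (simp add: append.simps)
  fix t s r u :: nat
  have "emono [t, s, r, u] = - (emono [t, s, u, r] :: 'a even_grass)"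
    using emono_swap[of "[t, s]" "[]" r u, where 'a = 'a] by (simp add: append.simps)
  also have "\<dots> = emono [t, u, s, r]"
    using emono_swap[of "[t]" "[r]" s u, where 'a = 'a] by (simp add: append.simps minus_minus)
  finally show "emono [t, s] * emono [r, u] = (emono [t, u] * emono [s, r] :: 'a even_grass)"
    unfolding app .
qed

section \<open>Signed sums over orderings\<close>

definition scmat :: "(nat \<Rightarrow> nat \<Rightarrow> 'a::comm_ring_1) \<Rightarrow> nat \<Rightarrow> nat \<Rightarrow> 'a even_grass" where
  "scmat A = (\<lambda>i j. scalar_even (A i j))"

lemma mmul_scmat: "mmul n (scmat A) (scmat B) = scmat (mmul n A B)"
  by (simp add: mmul_def scmat_def scalar_even_sum scalar_even_mult)

lemma mtr_scmat: "mtr n (scmat A) = scalar_even (mtr n A)"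
  by (simp add: mtr_def scmat_def scalar_even_sum)

lemma mword_scmat: "mword n (\<lambda>t. scmat (a t)) w = scmat (mword n a w)"
proof (induction w)
  case Nil
  show ?case by (intro ext) (simp add: mid_def scmat_def scalar_even_0 scalar_even_1)
qed (simp add: mmul_scmat)

lemma card_eq_length_permutation: "w \<in> permutations_of_set L \<Longrightarrow> length w = card L"
  by (auto simp: permutations_of_set_def distinct_card)

text \<open>In X^(2m) the coefficient at \<open>L\<close> receives exactly the words using each
  letter of \<open>L\<close> once, each with its sign, and the power is 0 by
  \<open>mpow_eq_0\<close>.\<close>

theorem amitsur_levitzki_even:
  fixes a :: "nat \<Rightarrow> nat \<Rightarrow> nat \<Rightarrow> 'a::{idom,ring_char_0}"
  assumes L: "finite L" "card L = 2 * m" and m: "m \<ge> n" and ij: "i < n" "j < n"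
  shows "(\<Sum>w\<in>permutations_of_set L. lsign w * mword n a w i j) = 0"
proof -
  let ?\<theta> = "\<lambda>t s. emono [t, s] :: 'a even_grass"
  interpret anticommuting_combination n L "\<lambda>t. scmat (a t)" ?\<theta>
    by (rule anticommuting_combination_emono)
  have sub: "permutations_of_set L \<subseteq> words L (2 * m)"
    using L by (auto simp: words_def permutations_of_set_def distinct_card)
  have mw: "mword n (\<lambda>t. scmat (a t)) w i j = scalar_even (mword n a w i j)" for w
    unfolding mword_scmat by (simp only: scmat_def)
  have "(\<Sum>w\<in>permutations_of_set L. lsign w * mword n a w i j)
      = (\<Sum>w\<in>words L (2 * m). coeff_even (W w * mword n (\<lambda>t. scmat (a t)) w i j) L)"
  proof (rule sum.mono_neutral_cong_left[OF finite_words[OF L(1)] sub])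
    show "\<forall>w\<in>words L (2 * m) - permutations_of_set L. coeff_even (W w * mword n (\<lambda>t. scmat (a t)) w i j) L = 0"
      by (auto simp: mw coeff_even_mult_scalar words_def pairing_word_emono coeff_emono permutations_of_set_def)
    show "lsign w * mword n a w i j = coeff_even (W w * mword n (\<lambda>t. scmat (a t)) w i j) L"
      if "w \<in> permutations_of_set L" for w
      using that sub by (auto simp: mw coeff_even_mult_scalar words_def pairing_word_emono coeff_emono permutations_of_set_def)
  qed
  also have "\<dots> = coeff_even (mpow n T m i j) L"
    by (simp add: mpow_eq_sum_words coeff_even_sum)
  also have "\<dots> = 0"
    using mpow_eq_0[OF ij m] by simp
  finally show ?thesis .
qed

lemma sum_triples_words:
  assumes "finite L"
  shows "(\<Sum>(p,q,r)\<in>triples N. \<Sum>u\<in>words L p. \<Sum>v\<in>words L q. \<Sum>w\<in>words L r. g u v w)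
    = (\<Sum>(u,v,w)\<in>{(u,v,w). set (u @ v @ w) \<subseteq> L \<and> length (u @ v @ w) = N}. g u v w)"
proof -
  let ?D = "Sigma (triples N) (\<lambda>(p,q,r). words L p \<times> words L q \<times> words L r)"
  have "(\<Sum>(p,q,r)\<in>triples N. \<Sum>u\<in>words L p. \<Sum>v\<in>words L q. \<Sum>w\<in>words L r. g u v w)
     = (\<Sum>x\<in>triples N. \<Sum>(u,v,w)\<in>(case x of (p,q,r) \<Rightarrow> words L p \<times> words L q \<times> words L r). g u v w)"
    by (intro sum.cong refl) (auto simp: sum.cartesian_product)
  also have "\<dots> = (\<Sum>(x,(u,v,w))\<in>?D. g u v w)"
    by (subst sum.Sigma) (use assms in \<open>auto intro!: finite_cartesian_product finite_words\<close>)
  also have "\<dots> = (\<Sum>(u,v,w)\<in>{(u,v,w). set (u @ v @ w) \<subseteq> L \<and> length (u @ v @ w) = N}. g u v w)"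
    by (rule sum.reindex_bij_witness[where j = "\<lambda>(x,y). y" and
          i = "\<lambda>(u,v,w). ((length u, length v, length w), (u,v,w))"])
      (auto simp: words_def triples_def)
  finally show ?thesis .
qed

section \<open>Cutting orderings at distinguished letters\<close>

definition splits :: "'l set \<Rightarrow> ('l list \<times> 'l list \<times> 'l list) set" where
  "splits L = {(u,v,w). u @ v @ w \<in> permutations_of_set L}"

text \<open>The counterpart over the ground ring of \<open>V\<close>, which lives over the even ring
  in the applications.\<close>

definition mtr3 where
  "mtr3 n P A Q B R C = mtr n (mmul n P (mmul n A (mmul n Q (mmul n B (mmul n R C)))))"

text \<open>This is the coefficient at \<open>L\<close> of \<open>sum_triples_S_eq_0\<close>, where
  the number of factors X equals the cardinality of \<open>L\<close>. Words with a repeated letter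
  do not contribute to it.\<close>

theorem sum_splits_eq_0:
  fixes a :: "nat \<Rightarrow> nat \<Rightarrow> nat \<Rightarrow> 'a::{idom,ring_char_0}"
  assumes n: "n \<ge> 2" and L: "finite L" "card L = 4 * n - 4"
  shows "(\<Sum>(u,v,w)\<in>splits L. (-1) ^ length v * lsign (u @ v @ w) *
      (mtr3 n (mword n a u) A (mword n a v) B (mword n a w) C + mtr3 n (mword n a u) B (mword n a v) A (mword n a w) C)) = 0"
proof -
  let ?\<theta> = "\<lambda>t s. emono [t, s] :: 'a even_grass"
  interpret anticommuting_combination n L "\<lambda>t. scmat (a t)" ?\<theta>
    by (rule anticommuting_combination_emono)
  let ?D = "{(u,v,w). set (u @ v @ w) \<subseteq> L \<and> length (u @ v @ w) = 4 * n - 4}"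
  let ?h = "\<lambda>u v w. mtr3 n (mword n a u) A (mword n a v) B (mword n a w) C + mtr3 n (mword n a u) B (mword n a v) A (mword n a w) C"
  let ?g = "\<lambda>u v w. (-1) ^ length v * (W (u @ v @ w) * scalar_even (?h u v w))"
  have even: "even (4 * n - 4)" by simp
  have finD: "finite ?D"
  proof (rule finite_subset)
    show "?D \<subseteq> {w. set w \<subseteq> L \<and> length w \<le> 4 * n - 4} \<times> {w. set w \<subseteq> L \<and> length w \<le> 4 * n - 4} \<times> {w. set w \<subseteq> L \<and> length w \<le> 4 * n - 4}"
      by auto
  qed (use L finite_lists_length_le in \<open>auto intro!: finite_cartesian_product\<close>)
  have sub: "splits L \<subseteq> ?D"
    using L by (auto simp: splits_def permutations_of_set_def) (metis distinct_card length_append distinct_append set_append Un_assoc)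
  have V: "V (scmat P) (scmat Q) (scmat R) (scmat A) (scmat B) (scmat C) = scalar_even (mtr3 n P A Q B R C)"
    for P Q R A B C :: "nat \<Rightarrow> nat \<Rightarrow> 'a"
    by (simp add: V_def mtr3_def mmul_scmat mtr_scmat)
  \<comment> \<open>The power of -1 is formed in the even ring on the left and in the ground ring on
    the right; parity decides both.\<close>
  have c: "coeff_even (?g u v w) L = (-1) ^ length v * (coeff_even (W (u @ v @ w)) L * ?h u v w)" for u v w
  proof (cases "even (length v)")
    case True
    then show ?thesis by (simp only: coeff_even_mult_scalar neg_one_even_power mult_1_left)
  next
    case False
    then show ?thesis by (simp only: coeff_even_mult_scalar neg_one_odd_power mult_minus_left mult_1_left coeff_even_uminus simp_thms not_False_eq_True)
  qed
  have "(\<Sum>(u,v,w)\<in>splits L. (-1) ^ length v * lsign (u @ v @ w) * ?h u v w) = (\<Sum>(u,v,w)\<in>?D. coeff_even (?g u v w) L)"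
  proof (rule sum.mono_neutral_cong_left[OF finD sub])
    show "\<forall>x\<in>?D - splits L. (case x of (u,v,w) \<Rightarrow> coeff_even (?g u v w) L) = 0"
    proof (intro ballI)
      fix x assume x: "x \<in> ?D - splits L"
      obtain u v w where uvw: "x = (u,v,w)" by (cases x)
      have "even (length (u @ v @ w))" using x uvw even by simp
      moreover have "\<not> (distinct (u @ v @ w) \<and> L = set (u @ v @ w))" using x uvw by (auto simp: splits_def permutations_of_set_def)
      ultimately show "(case x of (u,v,w) \<Rightarrow> coeff_even (?g u v w) L) = 0"
        unfolding uvw prod.case c by (simp only: pairing_word_emono coeff_emono if_False mult_zero_left mult_zero_right)
    qed
    show "(case x of (u,v,w) \<Rightarrow> (-1) ^ length v * lsign (u @ v @ w) * ?h u v w) = (case x of (u,v,w) \<Rightarrow> coeff_even (?g u v w) L)"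
      if x: "x \<in> splits L" for x
    proof -
      obtain u v w where uvw: "x = (u,v,w)" by (cases x)
      have "length (u @ v @ w) = 4 * n - 4" using x uvw sub by auto
      then have "even (length (u @ v @ w))" by (simp only: even)
      moreover have "distinct (u @ v @ w) \<and> L = set (u @ v @ w)" using x uvw by (auto simp: splits_def permutations_of_set_def)
      ultimately show ?thesis
        unfolding uvw prod.case c by (simp only: pairing_word_emono coeff_emono if_True mult.assoc simp_thms)
    qed
  qed
  also have "\<dots> = coeff_even (\<Sum>(u,v,w)\<in>?D. ?g u v w) L"
    by (simp add: coeff_even_sum case_prod_beta)
  also have "(\<Sum>(u,v,w)\<in>?D. ?g u v w) = (\<Sum>(p,q,r)\<in>triples (4 * n - 4). \<Sum>u\<in>words L p. \<Sum>v\<in>words L q. \<Sum>w\<in>words L r. ?g u v w)"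
    by (rule sum_triples_words[OF L(1), symmetric])
  also have "\<dots> = (\<Sum>(p,q,r)\<in>triples (4 * n - 4). (-1) ^ q * (S p q r (scmat A) (scmat B) (scmat C) + S p q r (scmat B) (scmat A) (scmat C)))"
  proof (intro sum.cong refl, clarify)
    fix p q r
    have "(\<Sum>u\<in>words L p. \<Sum>v\<in>words L q. \<Sum>w\<in>words L r. ?g u v w)
       = (\<Sum>u\<in>words L p. \<Sum>v\<in>words L q. \<Sum>w\<in>words L r. (-1) ^ q * (W (u @ v @ w) * scalar_even (?h u v w)))"
      by (intro sum.cong refl) (simp add: words_def)
    then show "(\<Sum>u\<in>words L p. \<Sum>v\<in>words L q. \<Sum>w\<in>words L r. ?g u v w)
       = (-1) ^ q * (S p q r (scmat A) (scmat B) (scmat C) + S p q r (scmat B) (scmat A) (scmat C))"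
      unfolding S_def mword_scmat V
      by (simp add: scalar_even_add sum_distrib_left sum.distrib distrib_left)
  qed
  also have "\<dots> = 0"
    by (rule sum_triples_S_eq_0[OF n])
  finally show ?thesis by simp
qed


text \<open>An ordering ending in \<open>z\<close> is cut uniquely at \<open>x\<close> and
  \<open>y\<close>; the two summands record which of these comes first.\<close>

lemma sum_permutations_last:
  fixes h :: "nat list \<Rightarrow> 'a::comm_ring_1"
  assumes x: "x \<notin> L" "y \<notin> L" "z \<notin> L" "x \<noteq> y" "x \<noteq> z" "y \<noteq> z" and L: "finite L"
  shows "(\<Sum>l | l \<in> permutations_of_set (insert x (insert y (insert z L))) \<and> last l = z. h l)
    = (\<Sum>(u,v,w)\<in>splits L. h (u @ x # v @ y # w @ [z]) + h (u @ y # v @ x # w @ [z]))"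
proof -
  let ?P = "permutations_of_set (insert x (insert y (insert z L)))"
  define e where "e x y = (\<lambda>(u,v,w). u @ x # v @ y # w @ [z])" for x y
  have inj: "inj_on (e x y) (splits L)" if "x \<notin> L" "y \<notin> L" "x \<noteq> y" for x y
  proof (rule inj_onI)
    fix s s' assume *: "s \<in> splits L" "s' \<in> splits L" "e x y s = e x y s'"
    obtain u v w u' v' w' where s: "s = (u, v, w)" "s' = (u', v', w')" by (metis prod_cases3)
    have "x \<notin> set u" "x \<notin> set (v @ y # w)" "y \<notin> set v" "y \<notin> set w"
      using * s that by (auto simp: splits_def permutations_of_set_def)
    then show "s = s'"
      using *(3) s by (simp add: e_def append_Cons_eq_iff)
  qed
  have sub: "e a b ` splits L \<subseteq> {l \<in> ?P. last l = z}" if "{a, b} = {x, y}" for a b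
    using that x by (auto simp: e_def splits_def permutations_of_set_def doubleton_eq_iff)
  have sup: "l \<in> e x y ` splits L \<union> e y x ` splits L" if l: "l \<in> ?P" "last l = z" for l
  proof -
    have d: "distinct l" "set l = insert x (insert y (insert z L))" using l by (auto simp: permutations_of_set_def)
    then have "l \<noteq> []" by auto
    then obtain m where m: "l = m @ [z]" using l(2) append_butlast_last_id by metis
    have dm: "distinct m" "set m = insert x (insert y L)"
      using d m x by auto
    from dm have "x \<in> set m" by simp
    then obtain p q where pq: "m = p @ x # q" by (meson split_list)
    have y: "y \<in> set p \<or> y \<in> set q" using dm pq x by auto
    then show ?thesis
    proof
      assume "y \<in> set q"
      then obtain v w where "q = v @ y # w" by (meson split_list)
      then have "l = e x y (p, v, w)" "(p,v,w) \<in> splits L"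
        using m pq dm x by (auto simp: e_def splits_def permutations_of_set_def)
      then show ?thesis by blast
    next
      assume "y \<in> set p"
      then obtain u v where "p = u @ y # v" by (meson split_list)
      then have "l = e y x (u, v, q)" "(u,v,q) \<in> splits L"
        using m pq dm x by (auto simp: e_def splits_def permutations_of_set_def)
      then show ?thesis by blast
    qed
  qed
  have eq: "{l \<in> ?P. last l = z} = e x y ` splits L \<union> e y x ` splits L"
  proof (rule equalityI)
    show "{l \<in> ?P. last l = z} \<subseteq> e x y ` splits L \<union> e y x ` splits L" using sup by blast
    show "e x y ` splits L \<union> e y x ` splits L \<subseteq> {l \<in> ?P. last l = z}"
      using sub[of x y] sub[of y x] by blast
  qed
  have disj: "e x y ` splits L \<inter> e y x ` splits L = {}"
  proof (rule ccontr)
    assume "e x y ` splits L \<inter> e y x ` splits L \<noteq> {}"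
    then obtain u v w u' v' w' where *: "(u,v,w) \<in> splits L" "(u',v',w') \<in> splits L" "e x y (u,v,w) = e y x (u',v',w')"
      by (auto simp: image_iff)
    have "x \<notin> set u" "x \<notin> set v" "x \<notin> set w" "y \<notin> set u" "y \<notin> set v" "y \<notin> set w"
      "x \<notin> set u'" "x \<notin> set v'" "x \<notin> set w'" "y \<notin> set u'" "y \<notin> set v'" "y \<notin> set w'"
      using * x by (auto simp: splits_def permutations_of_set_def)
    moreover have "filter (\<lambda>t. t \<in> {x, y}) s = []" if "x \<notin> set s" "y \<notin> set s" for s
      using that by (induction s) auto
    ultimately have "filter (\<lambda>t. t \<in> {x, y}) (e x y (u,v,w)) = [x, y]" "filter (\<lambda>t. t \<in> {x, y}) (e y x (u',v',w')) = [y, x]"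
      using x by (simp_all add: e_def)
    then show False using *(3) x by auto
  qed
  have fin: "finite (splits L)"
  proof (rule finite_subset)
    show "splits L \<subseteq> {w. set w \<subseteq> L \<and> length w \<le> card L} \<times> {w. set w \<subseteq> L \<and> length w \<le> card L} \<times> {w. set w \<subseteq> L \<and> length w \<le> card L}"
    proof (clarify)
      fix u v w assume "(u,v,w) \<in> splits L"
      then have "length (u @ v @ w) = card L" "set (u @ v @ w) \<subseteq> L"
        by (auto simp only: splits_def mem_Collect_eq prod.case card_eq_length_permutation permutations_of_setD)
      then show "u \<in> {w. set w \<subseteq> L \<and> length w \<le> card L} \<and> (v, w) \<in> {w. set w \<subseteq> L \<and> length w \<le> card L} \<times> {w. set w \<subseteq> L \<and> length w \<le> card L}"
        by auto
    qed
  qed (use L finite_lists_length_le in \<open>auto intro!: finite_cartesian_product\<close>)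
  have "sum h {l \<in> ?P. last l = z} = sum h (e x y ` splits L) + sum h (e y x ` splits L)"
    unfolding eq using fin disj by (intro sum.union_disjoint) auto
  also have "\<dots> = (\<Sum>s\<in>splits L. h (e x y s)) + (\<Sum>s\<in>splits L. h (e y x s))"
    using x by (simp add: sum.reindex[OF inj] o_def)
  finally show ?thesis
    by (simp add: e_def case_prod_beta sum.distrib)
qed

text \<open>Gathering the three letters at the end moves \<open>x\<close> past \<open>v\<close> and
  \<open>w\<close>, and \<open>y\<close> past \<open>w\<close>, leaving (-1)^(length v). The
  filtered word cancels the sign of the gathered letters, so both orders of \<open>x\<close> and
  \<open>y\<close> enter with equal sign, as \<open>sum_splits_eq_0\<close> demands.\<close>

theorem sum_permutations_last_eq_0:
  fixes a :: "nat \<Rightarrow> nat \<Rightarrow> nat \<Rightarrow> 'a::{idom,ring_char_0}"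
  assumes n: "n \<ge> 2" and L: "finite L" "card L = 4 * n - 4"
    and x: "x \<notin> L" "y \<notin> L" "z \<notin> L" "x \<noteq> y" "x \<noteq> z" "y \<noteq> z"
  shows "(\<Sum>l | l \<in> permutations_of_set (insert x (insert y (insert z L))) \<and> last l = z.
     lsign l * lsign (filter (\<lambda>t. t \<in> {x, y, z}) l) * mtr n (mword n a l)) = 0"
proof -
  \<comment> \<open>The sign between \<open>L\<close> and the distinguished letters is the same for
    all orderings and factors out.\<close>
  let ?c = "gsign L {x, y, z} :: 'a"
  have trm: "lsign (u @ x # v @ y # w @ [z]) * lsign (filter (\<lambda>t. t \<in> {x, y, z}) (u @ x # v @ y # w @ [z]))
       * mtr n (mword n a (u @ x # v @ y # w @ [z]))
     = gsign L {x, y, z} * ((-1) ^ length v * lsign (u @ v @ w) * mtr3 n (mword n a u) (a x) (mword n a v) (a y) (mword n a w) (a z))"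
    if s: "(u,v,w) \<in> splits L" and x: "x \<notin> L" "y \<notin> L" "z \<notin> L" "x \<noteq> y" "x \<noteq> z" "y \<noteq> z" for x y u v w
  proof -
    have d: "distinct (u @ v @ w)" "set (u @ v @ w) = L" using s by (auto simp: splits_def permutations_of_set_def)
    have d': "distinct (u @ x # v @ y # w @ [z])" using d x by auto
    have "filter (\<lambda>t. t \<in> {x, y, z}) u = []" "filter (\<lambda>t. t \<in> {x, y, z}) v = []" "filter (\<lambda>t. t \<in> {x, y, z}) w = []"
      using d x by (auto simp: filter_empty_conv)
    then have f: "filter (\<lambda>t. t \<in> {x, y, z}) (u @ x # v @ y # w @ [z]) = [x, y, z]" by simp
    have "(lsign (u @ x # v @ y # w @ [z]) :: 'a) = (-1) ^ length v * lsign (u @ v @ x # y # w @ [z])"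
      using lsign_move[of u x v "y # w @ [z]"] d' by simp
    also have "(lsign (u @ v @ x # y # w @ [z]) :: 'a) = (-1) ^ length w * lsign (u @ v @ x # w @ [y, z])"
      using lsign_move[of "u @ v @ [x]" y w "[z]"] d' by (simp del: distinct_append) auto
    also have "(lsign (u @ v @ x # w @ [y, z]) :: 'a) = (-1) ^ length w * lsign ((u @ v @ w) @ [x, y, z])"
      using lsign_move[of "u @ v" x w "[y, z]"] d' by (simp del: distinct_append) auto
    also have "(lsign ((u @ v @ w) @ [x, y, z]) :: 'a) = lsign (u @ v @ w) * lsign [x, y, z] * gsign L {x, y, z}"
      using d d' by (subst lsign_append) auto
    finally have "(lsign (u @ x # v @ y # w @ [z]) :: 'a) * lsign [x, y, z]
      = (-1) ^ length v * ((-1) ^ length w * (-1) ^ length w) * lsign (u @ v @ w) * (lsign [x, y, z] * lsign [x, y, z]) * gsign L {x, y, z}"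
      by (simp only: ac_simps)
    also have "\<dots> = gsign L {x, y, z} * ((-1) ^ length v * lsign (u @ v @ w))"
      by (simp add: lsign_square power_mult_distrib[symmetric] ac_simps del: lsign.simps)
    finally have sgn: "(lsign (u @ x # v @ y # w @ [z]) :: 'a) * lsign [x, y, z] = \<dots>" .
    have "mtr n (mword n a (u @ x # v @ y # w @ [z])) = mtr3 n (mword n a u) (a x) (mword n a v) (a y) (mword n a w) (a z)"
    proof -
      have "mtr n (mword n a (u @ x # v @ y # w @ [z])) = mtr n (mmul n (mword n a u) (mmul n (a x) (mmul n (mword n a v)
         (mmul n (a y) (mmul n (mword n a w) (mmul n (a z) mid))))))"
        by (simp only: mtr_mword_append mmul_mword_append mword.simps)
      also have "\<dots> = mtr n (mmul n (mmul n (mword n a u) (mmul n (a x) (mmul n (mword n a v) (mmul n (a y) (mmul n (mword n a w) (a z)))))) mid)"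
        by (simp only: mmul_assoc)
      also have "\<dots> = mtr3 n (mword n a u) (a x) (mword n a v) (a y) (mword n a w) (a z)"
        by (simp only: mmul_mid_inner mtr3_def)
      finally show ?thesis .
    qed
    then show ?thesis unfolding f sgn by (simp only: mult.assoc)
  qed
  have "(\<Sum>l | l \<in> permutations_of_set (insert x (insert y (insert z L))) \<and> last l = z.
     lsign l * lsign (filter (\<lambda>t. t \<in> {x, y, z}) l) * mtr n (mword n a l))
    = (\<Sum>(u,v,w)\<in>splits L. ?c * ((-1) ^ length v * lsign (u @ v @ w) *
      (mtr3 n (mword n a u) (a x) (mword n a v) (a y) (mword n a w) (a z)
        + mtr3 n (mword n a u) (a y) (mword n a v) (a x) (mword n a w) (a z))))"
    unfolding sum_permutations_last[OF x L(1)]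
  proof (intro sum.cong refl, clarify)
    fix u v w assume s: "(u,v,w) \<in> splits L"
    show "lsign (u @ x # v @ y # w @ [z]) * lsign (filter (\<lambda>t. t \<in> {x, y, z}) (u @ x # v @ y # w @ [z]))
       * mtr n (mword n a (u @ x # v @ y # w @ [z]))
      + lsign (u @ y # v @ x # w @ [z]) * lsign (filter (\<lambda>t. t \<in> {x, y, z}) (u @ y # v @ x # w @ [z]))
       * mtr n (mword n a (u @ y # v @ x # w @ [z]))
      = ?c * ((-1) ^ length v * lsign (u @ v @ w) *
      (mtr3 n (mword n a u) (a x) (mword n a v) (a y) (mword n a w) (a z)
        + mtr3 n (mword n a u) (a y) (mword n a v) (a x) (mword n a w) (a z)))"
      using trm[OF s, of x y] trm[OF s, of y x] x
      by (simp only: insert_commute[of y x] distrib_left) simp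
  qed
  also have "\<dots> = ?c * (\<Sum>(u,v,w)\<in>splits L. (-1) ^ length v * lsign (u @ v @ w) *
      (mtr3 n (mword n a u) (a x) (mword n a v) (a y) (mword n a w) (a z)
        + mtr3 n (mword n a u) (a y) (mword n a v) (a x) (mword n a w) (a z)))"
    by (simp add: sum_distrib_left case_prod_beta)
  also have "\<dots> = 0"
    using sum_splits_eq_0[OF n L, of a "a x" "a y" "a z"] by simp
  finally show ?thesis .
qed

section \<open>Standard polynomials as sums over lists\<close>

text \<open>Adjacent swaps connect all orderings: the first letter of \<open>u\<close> is carried to
  the front of \<open>v\<close>, and induction continues behind the common prefix.\<close>

lemma permutations_of_set_swap_invariant:
  assumes swap: "\<And>xs x y ys. xs @ x # y # ys \<in> permutations_of_set A \<Longrightarrow> h (xs @ y # x # ys) = h (xs @ x # y # ys)"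
    and "u \<in> permutations_of_set A" "v \<in> permutations_of_set A"
  shows "h u = h v"
proof -
  have move: "h (p @ v1 @ x # v2) = h (p @ x # v1 @ v2)" if "p @ x # v1 @ v2 \<in> permutations_of_set A" for p v1 x v2
    using that
  proof (induction v1 arbitrary: v2 rule: rev_induct)
    case (snoc y v1)
    have "(p @ v1) @ x # y # v2 \<in> permutations_of_set A"
      using snoc.prems by (auto simp: permutations_of_set_def)
    then have "h (p @ (v1 @ [y]) @ x # v2) = h (p @ v1 @ x # y # v2)"
      using swap[of "p @ v1" x y v2] by simp
    then show ?case using snoc by simp
  qed simp
  have "h (p @ u) = h (p @ v)" if "p @ u \<in> permutations_of_set A" "p @ v \<in> permutations_of_set A" for p u v
    using that
  proof (induction u arbitrary: p v)
    case Nil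
    then have "set v \<subseteq> set p" "distinct (p @ v)" by (auto simp: permutations_of_set_def)
    then have "set v \<subseteq> set p" "set p \<inter> set v = {}" by auto
    then have "set v = {}" by (simp only: Int_absorb1)
    then have "v = []" by simp
    then show ?case by simp
  next
    case (Cons x u)
    have d: "distinct (p @ x # u)" "set (p @ x # u) = A" "distinct (p @ v)" "set (p @ v) = A"
      using Cons.prems by (auto simp: permutations_of_set_def)
    then have "x \<in> set v" by auto
    then obtain v1 v2 where v: "v = v1 @ x # v2" by (meson split_list)
    have perm: "p @ x # v1 @ v2 \<in> permutations_of_set A"
      using d(3,4) unfolding v by (auto simp: permutations_of_set_def)
    have "h (p @ v) = h (p @ x # v1 @ v2)"
      unfolding v by (rule move[OF perm])
    also have "\<dots> = h (p @ x # u)"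
      using Cons.IH[of "p @ [x]" "v1 @ v2"] Cons.prems(1) perm by simp
    finally show ?case ..
  qed
  from this[of "[]" u v] show ?thesis using assms(2,3) by simp
qed

definition perm_of_list :: "nat list \<Rightarrow> nat \<Rightarrow> nat" where
  "perm_of_list l = (\<lambda>t. if t < length l then l ! t else t)"

lemma perm_of_list_permutes:
  assumes "l \<in> permutations_of_set {0..<k}"
  shows "perm_of_list l permutes {0..<k}"
proof (rule bij_imp_permutes)
  have l: "length l = k" "distinct l" "set l = {0..<k}"
    using assms by (auto simp: permutations_of_set_def dest: distinct_card)
  have "bij_betw (\<lambda>t. l ! t) {..<length l} (set l)"
    by (rule bij_betw_nth) (use l in auto)
  then have "bij_betw (perm_of_list l) {..<length l} (set l)"
    by (rule bij_betw_cong[THEN iffD1, rotated]) (simp add: perm_of_list_def)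
  then show "bij_betw (perm_of_list l) {0..<k} {0..<k}"
    using l by (simp add: lessThan_atLeast0)
  show "perm_of_list l t = t" if "t \<notin> {0..<k}" for t
    using that l by (simp add: perm_of_list_def)
qed

text \<open>Both signs flip under an adjacent swap, so their product is constant; on the increasing
  ordering it is 1.\<close>

lemma sign_perm_of_list:
  assumes "l \<in> permutations_of_set {0..<k}"
  shows "of_int (sign (perm_of_list l)) = (lsign l :: 'a::comm_ring_1)"
proof -
  define h where "h l = of_int (sign (perm_of_list l)) * (lsign l :: 'a)" for l
  have id: "[0..<k] \<in> permutations_of_set {0..<k}" by (auto simp: permutations_of_set_def)
  have "h l = h [0..<k]"
  proof (rule permutations_of_set_swap_invariant[OF _ assms id])
    fix xs x y ys assume p: "xs @ x # y # ys \<in> permutations_of_set {0..<k}"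
    then have d: "distinct (xs @ x # y # ys)" by (auto simp: permutations_of_set_def)
    have "perm_of_list (xs @ y # x # ys) = perm_of_list (xs @ x # y # ys) \<circ> transpose (length xs) (Suc (length xs))"
      by (rule ext) (auto simp: perm_of_list_def transpose_def nth_append nth_Cons' not_less_eq)
    then have "sign (perm_of_list (xs @ y # x # ys))
        = sign (perm_of_list (xs @ x # y # ys)) * sign (transpose (length xs) (Suc (length xs)))"
      using permutation_permutes perm_of_list_permutes[OF p]
      by (metis finite_atLeastLessThan permutation_swap_id sign_compose)
    then have "sign (perm_of_list (xs @ y # x # ys)) = - sign (perm_of_list (xs @ x # y # ys))"
      by (simp add: sign_swap_id)
    then show "h (xs @ y # x # ys) = h (xs @ x # y # ys)"
      by (simp add: h_def lsign_swap[OF d])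
  qed
  also have "\<dots> = 1"
  proof -
    have "perm_of_list [0..<k] = id" by (rule ext) (simp add: perm_of_list_def)
    moreover have "lsign [m..<m + k] = (1::'a)" for m k
    proof (induction k arbitrary: m)
      case (Suc k)
      have "{(a, b). a \<in> {m} \<and> b \<in> {Suc m..<Suc (m + k)} \<and> b < a} = {}" by auto
      then have "(gsign {m} {Suc m..<Suc (m + k)} :: 'a) = 1"
        by (simp only: gsign_def card.empty power_0)
      moreover have "[m..<m + Suc k] = m # [Suc m..<Suc m + k]"
        by (simp add: upt_conv_Cons del: upt_Suc)
      ultimately show ?case
        using Suc[of "Suc m"] by (simp del: upt_Suc)
    qed simp
    from this[of 0 k] have "lsign [0..<k] = (1::'a)" by simp
    ultimately show ?thesis by (simp add: h_def)
  qed
  finally have "of_int (sign (perm_of_list l)) * (lsign l :: 'a) * lsign l = lsign l" by (simp add: h_def)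
  then show ?thesis by (simp add: mult.assoc lsign_square)
qed

lemma std_poly_eq_sum_lists:
  "std_poly n k x i j S = (\<Sum>l\<in>permutations_of_set {0..<k}. lsign l * gmat_prod n (map x l) i j S)"
  unfolding std_poly_def
proof (rule sum.reindex_bij_witness[where i = perm_of_list and j = "\<lambda>p. map p [0..<k]"])
  fix p assume "p \<in> {p. p permutes {0..<k}}"
  then have p: "p permutes {0..<k}" by simp
  show inv: "perm_of_list (map p [0..<k]) = p"
    using p by (intro ext) (auto simp: perm_of_list_def permutes_not_in)
  show perm: "map p [0..<k] \<in> permutations_of_set {0..<k}"
    using permutes_image[OF p] permutes_inj_on[OF p] by (auto simp: permutations_of_set_def distinct_map)
  show "lsign (map p [0..<k]) * gmat_prod n (map x (map p [0..<k])) i j S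
      = of_int (sign p) * gmat_prod n (map (\<lambda>t. x (p t)) [0..<k]) i j S"
    using sign_perm_of_list[OF perm, where 'a = 'a] by (simp add: inv o_def)
next
  fix l assume l: "l \<in> permutations_of_set {0..<k}"
  then have len: "length l = k" by (auto simp: permutations_of_set_def dest: distinct_card)
  show "map (perm_of_list l) [0..<k] = l"
    by (rule nth_equalityI) (auto simp: len perm_of_list_def)
  show "perm_of_list l \<in> {p. p permutes {0..<k}}"
    using perm_of_list_permutes[OF l] by simp
qed

section \<open>Products of scaled matrices and of basis monomials\<close>

lemma gmult_scale: "gmult (\<lambda>S. c * x S) (\<lambda>S. d * y S) S = c * d * gmult x y S"
  by (simp add: gmult_def sum_distrib_left ac_simps)

lemma gmult_scale_right: "gmult x (\<lambda>S. d * y S) = (\<lambda>S. d * gmult x y S)"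
  by (rule ext) (simp add: gmult_def sum_distrib_left ac_simps)

lemma gmult_scale_left: "gmult (\<lambda>S. c * x S) y = (\<lambda>S. c * gmult x y S)"
  by (rule ext) (simp add: gmult_def sum_distrib_left ac_simps)

lemma gmult_sum_left: "gmult (\<lambda>S. \<Sum>b\<in>B. f b S) y = (\<lambda>S. \<Sum>b\<in>B. gmult (f b) y S)"
  unfolding gmult_def by (rule ext) (simp add: sum_distrib_left sum_distrib_right sum.swap[of _ B])

lemma gmult_sum_right: "gmult x (\<lambda>S. \<Sum>b\<in>B. f b S) = (\<lambda>S. \<Sum>b\<in>B. gmult x (f b) S)"
  unfolding gmult_def by (rule ext) (simp add: sum_distrib_left sum.swap[of _ B])

primrec gprod :: "'a::comm_ring_1 grass list \<Rightarrow> 'a grass" where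
  "gprod [] = gone"
| "gprod (v # vs) = gmult v (gprod vs)"

text \<open>The entries of \<open>a\<close> are scalars and pass through the Grassmann factors, so
  the matrix part and the Grassmann part separate.\<close>

lemma gmat_prod_scaled:
  "gmat_prod n (map (\<lambda>t i j S. a t i j * v t S) l) i j S = mword n a l i j * gprod (map v l) S"
proof (induction l arbitrary: i j S)
  case Nil
  then show ?case by (simp add: gmat_one_def mid_def)
next
  case (Cons t l)
  have IH: "gmat_prod n (map (\<lambda>t i j S. a t i j * v t S) l) i j = (\<lambda>S. mword n a l i j * gprod (map v l) S)" for i j
    by (rule ext) (rule Cons)
  show ?case
    by (simp add: gmat_mult_def IH gmult_scale mmul_def sum_distrib_right)
qed

definition gbasis :: "nat set \<Rightarrow> 'a::comm_ring_1 grass" where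
  "gbasis U = (\<lambda>S. if S = U then 1 else 0)"

lemma gmult_gbasis:
  assumes "finite U"
  shows "gmult (gbasis U) (gbasis U') S = (if finite U' \<and> U \<inter> U' = {} \<and> S = U \<union> U' then gsign U U' else 0)"
proof (cases "finite S")
  case True
  have "gmult (gbasis U) (gbasis U') S = (\<Sum>A\<in>Pow S. if A = U then (if S - U = U' then gsign U U' else 0) else 0)"
    unfolding gmult_def gbasis_def by (intro sum.cong refl) auto
  also have "\<dots> = (if U \<subseteq> S \<and> S - U = U' then gsign U U' else 0)"
    using True by simp
  also have "U \<subseteq> S \<and> S - U = U' \<longleftrightarrow> finite U' \<and> U \<inter> U' = {} \<and> S = U \<union> U'"
    using True by (auto intro: finite_subset)
  finally show ?thesis .
next
  case False
  then show ?thesis using assms by (auto simp: gmult_def)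
qed

lemma gmult_gbasis_swap:
  assumes "finite U" "finite U'"
  shows "gmult (gbasis U') (gbasis U) = (\<lambda>S. (-1) ^ (card U * card U') * gmult (gbasis U) (gbasis U') S)"
proof
  fix S
  have "(gsign U' U :: 'a) = (-1) ^ (card U * card U') * gsign U U'" if "U \<inter> U' = {}"
    using that assms by (intro gsign_swap) auto
  then show "gmult (gbasis U') (gbasis U) S = (-1) ^ (card U * card U') * (gmult (gbasis U) (gbasis U') S :: 'a)"
    using assms by (auto simp: gmult_gbasis)
qed

lemma gprod_swap:
  assumes "finite (U x)" "finite (U y)"
  shows "gprod (map (\<lambda>t. gbasis (U t)) (xs @ y # x # ys))
     = (\<lambda>S. (-1) ^ (card (U x) * card (U y)) * gprod (map (\<lambda>t. gbasis (U t)) (xs @ x # y # ys)) S)"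
proof (induction xs)
  case Nil
  show ?case
    using assms by (simp add: gmult_assoc[symmetric] gmult_gbasis_swap[of "U x" "U y"] gmult_scale_left)
next
  case (Cons a xs)
  then show ?case by (simp add: gmult_scale_right)
qed

text \<open>Only disjoint sets have a nonzero product, so degrees add up. This bounds the number of
  odd arguments.\<close>

lemma gprod_gbasis_nonzero:
  "gprod (map (\<lambda>t. gbasis (U t)) l) S \<noteq> (0 :: 'a::comm_ring_1) \<Longrightarrow> S = (\<Union>t\<in>set l. U t) \<and> card S = (\<Sum>t\<leftarrow>l. card (U t))"
proof (induction l arbitrary: S)
  case Nil
  then show ?case by (auto simp: gone_def split: if_splits)
next
  case (Cons t l)
  then have "gmult (gbasis (U t)) (gprod (map (\<lambda>t. gbasis (U t)) l)) S \<noteq> (0::'a)" by simp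
  then obtain A B where *: "finite A" "finite B" "A \<inter> B = {}" "S = A \<union> B" "gbasis (U t) A \<noteq> (0::'a)"
    "gprod (map (\<lambda>t. gbasis (U t)) l) B \<noteq> (0::'a)"
    by (rule gmult_nonzeroE)
  have "A = U t" using *(5) by (auto simp: gbasis_def split: if_splits)
  have "card S = card A + card B"
    unfolding *(4) using *(1-3) by (rule card_Un_disjoint)
  then have card: "card S = (\<Sum>t\<leftarrow>t # l. card (U t))"
    unfolding \<open>A = U t\<close> conjunct2[OF Cons.IH[OF *(6)]] by simp
  have "S = (\<Union>t\<in>set (t # l). U t)"
    unfolding *(4) \<open>A = U t\<close> conjunct1[OF Cons.IH[OF *(6)]] by simp
  then show ?case using card ..
qed

section \<open>Cyclic rotation\<close>

text \<open>Two lengths with an odd sum have an even product, so exchanging the blocks costs no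
  sign.\<close>

lemma lsign_commute:
  assumes "distinct (u @ v)" "odd (length (u @ v))"
  shows "lsign (u @ v) = (lsign (v @ u) :: 'a::comm_ring_1)"
proof -
  have "even (length v * length u)" using assms(2) by auto
  then have "(gsign (set u) (set v) :: 'a) = gsign (set v) (set u)"
    using assms(1) by (subst gsign_swap) (auto simp: distinct_card)
  moreover have "distinct (v @ u)" using assms(1) by auto
  ultimately show ?thesis
    by (simp only: lsign_append[OF assms(1)] lsign_append[OF \<open>distinct (v @ u)\<close>] mult.commute)
qed

lemma mtr_mword_commute: "mtr n (mword n a (u @ v)) = mtr n (mword n a (v @ u))"
  unfolding mtr_mword_append by (rule mtr_mmul_commute)

text \<open>The letters in \<open>Q\<close> behave as odd ones: reordering their Grassmann factors
  contributes the second sign.\<close>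

definition cyc_term :: "nat \<Rightarrow> (nat \<Rightarrow> nat \<Rightarrow> nat \<Rightarrow> 'a::comm_ring_1) \<Rightarrow> nat set \<Rightarrow> nat list \<Rightarrow> 'a" where
  "cyc_term n a Q l = lsign l * lsign (filter (\<lambda>t. t \<in> Q) l) * mtr n (mword n a l)"

lemma cyc_term_commute:
  assumes "u @ v \<in> permutations_of_set L" "odd (card L)" "odd (card Q)" "Q \<subseteq> L"
  shows "cyc_term n a Q (u @ v) = cyc_term n a Q (v @ u)"
proof -
  have d: "distinct (u @ v)" "set (u @ v) = L" using assms(1) by (auto simp: permutations_of_set_def)
  have "odd (length (u @ v))" using distinct_card[OF d(1)] d(2) assms(2) by simp
  moreover have "set (filter (\<lambda>t. t \<in> Q) (u @ v)) = Q" unfolding set_filter d(2) using assms(4) by auto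
  then have "length (filter (\<lambda>t. t \<in> Q) (u @ v)) = card Q"
    using distinct_card[OF distinct_filter[OF d(1), of "\<lambda>t. t \<in> Q"]] by simp
  then have "odd (length (filter (\<lambda>t. t \<in> Q) u @ filter (\<lambda>t. t \<in> Q) v))"
    using assms(3) by simp
  moreover have "distinct (filter (\<lambda>t. t \<in> Q) u @ filter (\<lambda>t. t \<in> Q) v)"
    using d(1) by auto
  ultimately show ?thesis
    unfolding cyc_term_def filter_append using d(1)
    by (intro arg_cong2[of _ _ _ _ "(*)"] lsign_commute mtr_mword_commute)
qed

lemma sum_cyc_term_last:
  assumes "odd (card L)" "odd (card Q)" "Q \<subseteq> L" "x \<in> L" "y \<in> L"
  shows "(\<Sum>l | l \<in> permutations_of_set L \<and> last l = x. cyc_term n a Q l)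
    = (\<Sum>l | l \<in> permutations_of_set L \<and> last l = y. cyc_term n a Q l)"
proof (cases "x = y")
  case False
  \<comment> \<open>\<open>rot z\<close> cuts directly behind \<open>z\<close> and exchanges the
    pieces; \<open>rot x\<close> undoes \<open>rot y\<close> on orderings that end in
    \<open>x\<close>.\<close>
  define rot where "rot z l = (let u = takeWhile (\<lambda>t. t \<noteq> z) l in drop (Suc (length u)) l @ u @ [z])" for z and l :: "nat list"
  have rot: "rot z (u @ z # v) = v @ u @ [z]" if "z \<notin> set u" for z u v
  proof -
    have "takeWhile (\<lambda>t. t \<noteq> z) (u @ z # v) = u"
      using that by (simp add: takeWhile_append)
    then show ?thesis by (simp add: rot_def)
  qed
  have *: "rot x (rot y l) = l \<and> rot y l \<in> permutations_of_set L \<and> last (rot y l) = y \<and> cyc_term n a Q (rot y l) = cyc_term n a Q l"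
    if l: "l \<in> permutations_of_set L" "last l = x" and xy: "x \<in> L" "y \<in> L" "x \<noteq> y" for x y l
  proof -
    have d: "distinct l" "set l = L" using permutations_of_setD[OF l(1)] by simp_all
    have "y \<in> set l" using d(2) xy(2) by simp
    then obtain u w where uw: "l = u @ y # w" by (meson split_list)
    then have "w \<noteq> []" using l(2) xy(3) by auto
    then obtain v where v: "w = v @ [x]" using l(2) uw append_butlast_last_id by (metis last_ConsR last_appendR list.distinct(1))
    have l': "l = u @ y # (v @ [x])" using uw v by simp
    have d': "distinct (u @ y # (v @ [x]))" using d(1) l' by simp
    have r: "rot y l = v @ x # (u @ [y])"
      unfolding l' using rot[of y u "v @ [x]"] d' by simp
    have "rot x (rot y l) = l"
      unfolding r unfolding l' using rot[of x v "u @ [y]"] d' by simp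
    moreover have "rot y l \<in> permutations_of_set L"
    proof (rule permutations_of_setI)
      show "set (rot y l) = L" unfolding r unfolding d(2)[symmetric] l' by auto
      show "distinct (rot y l)" unfolding r using d' by auto
    qed
    moreover have "cyc_term n a Q ((u @ [y]) @ (v @ [x])) = cyc_term n a Q ((v @ [x]) @ (u @ [y]))"
      by (rule cyc_term_commute[of _ _ L]) (use assms l l' in simp_all)
    ultimately show ?thesis unfolding r unfolding l' by simp
  qed
  show ?thesis
  proof (rule sum.reindex_bij_witness[where i = "rot x" and j = "rot y"])
    fix l assume "l \<in> {l \<in> permutations_of_set L. last l = x}"
    with *[of l x y] assms(4,5) False
    show "rot x (rot y l) = l" "rot y l \<in> {l \<in> permutations_of_set L. last l = y}"
      "cyc_term n a Q (rot y l) = cyc_term n a Q l" by simp_all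
  next
    fix l assume "l \<in> {l \<in> permutations_of_set L. last l = y}"
    with *[of l y x] assms(4,5) False
    show "rot y (rot x l) = l" "rot x l \<in> {l \<in> permutations_of_set L. last l = x}" by simp_all
  qed
qed simp

text \<open>Rotation puts a letter of \<open>Q\<close> last; the 4n - 4 letters outside
  \<open>Q\<close> are then the set required by \<open>sum_permutations_last_eq_0\<close>.\<close>

theorem sum_cyc_term_eq_0:
  fixes a :: "nat \<Rightarrow> nat \<Rightarrow> nat \<Rightarrow> 'a::{idom,ring_char_0}"
  assumes n: "n \<ge> 2" and L: "finite L" "card L = 4 * n - 1" and Q: "Q \<subseteq> L" "card Q = 3" and x: "x \<in> L"
  shows "(\<Sum>l | l \<in> permutations_of_set L \<and> last l = x. cyc_term n a Q l) = 0"
proof -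
  obtain p q r where pqr: "Q = {p, q, r}" "p \<noteq> q" "p \<noteq> r" "q \<noteq> r"
    using Q(2) by (auto simp: card_3_iff)
  define M where "M = L - Q"
  have M: "finite M" "card M = 4 * n - 4" "p \<notin> M" "q \<notin> M" "r \<notin> M" and LM: "L = insert p (insert q (insert r M))"
    using L Q pqr finite_subset[OF Q(1) L(1)] by (auto simp: M_def card_Diff_subset)
  have "odd (card L)" using L n by presburger
  then have "(\<Sum>l | l \<in> permutations_of_set L \<and> last l = x. cyc_term n a Q l)
     = (\<Sum>l | l \<in> permutations_of_set L \<and> last l = r. cyc_term n a Q l)"
    using Q x pqr by (intro sum_cyc_term_last) auto
  also have "\<dots> = 0"
    using sum_permutations_last_eq_0[OF n M(1,2), of p q r a] M pqr unfolding cyc_term_def pqr LM by simp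
  finally show ?thesis .
qed

theorem twisted_standard_sum_eq_0:
  fixes a :: "nat \<Rightarrow> nat \<Rightarrow> nat \<Rightarrow> 'a::{idom,ring_char_0}"
  assumes n: "n \<ge> 2" and k: "k = 4 * n - 2" and Q: "Q \<subseteq> {0..<k}" "card Q \<le> 3" and ij: "i < n" "j < n"
  shows "(\<Sum>l\<in>permutations_of_set {0..<k}. lsign l * lsign (filter (\<lambda>t. t \<in> Q) l) * mword n a l i j) = 0"
proof (cases "card Q \<le> 1")
  case True
  have "lsign (filter (\<lambda>t. t \<in> Q) l) = (1::'a)" if l: "l \<in> permutations_of_set {0..<k}" for l
  proof -
    have "set (filter (\<lambda>t. t \<in> Q) l) = Q"
      unfolding set_filter permutations_of_setD(1)[OF l] using Q by blast
    moreover have "distinct (filter (\<lambda>t. t \<in> Q) l)"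
      using permutations_of_setD(2)[OF l] by (rule distinct_filter)
    ultimately have "length (filter (\<lambda>t. t \<in> Q) l) \<le> 1"
      using True distinct_card[of "filter (\<lambda>t. t \<in> Q) l"] by simp
    then show ?thesis by (cases "filter (\<lambda>t. t \<in> Q) l") auto
  qed
  then have "(\<Sum>l\<in>permutations_of_set {0..<k}. lsign l * lsign (filter (\<lambda>t. t \<in> Q) l) * mword n a l i j)
      = (\<Sum>l\<in>permutations_of_set {0..<k}. lsign l * mword n a l i j)"
    by (intro sum.cong refl) simp
  \<comment> \<open>The even case of Amitsur-Levitzki applies, as k = 2 (2n - 1) and 2n - 1 is at
    least \<open>n\<close>.\<close>
  also have "\<dots> = 0"
    by (rule amitsur_levitzki_even[where m = "2 * n - 1"]) (use n k ij in auto)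
  finally show ?thesis .
next
  case False
  \<comment> \<open>The new letter \<open>k\<close> completes a two-element \<open>Q\<close> to
    three letters.\<close>
  define Q' where "Q' = (if card Q = 3 then Q else insert k Q)"
  have fin: "finite Q" using Q finite_subset by blast
  have kQ: "k \<notin> Q" using Q by auto
  have Q': "Q' \<subseteq> {0..<Suc k}" "card Q' = 3"
    using Q fin kQ False by (auto simp: Q'_def)
  \<comment> \<open>The letter \<open>k\<close> carries the matrix unit at (j, i), so the trace of a
    product ending in it is the entry (i, j) of the rest.\<close>
  define b where "b = a(k := \<lambda>r c. if r = j \<and> c = i then 1 else 0)"
  have b: "mword n b l = mword n a l" if "k \<notin> set l" for l
    using that by (induction l) (auto simp: b_def)
  have "(\<Sum>l | l \<in> permutations_of_set {0..<Suc k} \<and> last l = k. cyc_term n b Q' l) = 0"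
    by (rule sum_cyc_term_eq_0[OF n]) (use k n Q' in auto)
  also have "(\<Sum>l | l \<in> permutations_of_set {0..<Suc k} \<and> last l = k. cyc_term n b Q' l)
     = (\<Sum>l\<in>permutations_of_set {0..<k}. lsign l * lsign (filter (\<lambda>t. t \<in> Q) l) * mword n a l i j)"
  proof (rule sum.reindex_bij_witness[where i = "\<lambda>l. l @ [k]" and j = butlast])
    fix l assume "l \<in> {l \<in> permutations_of_set {0..<Suc k}. last l = k}"
    then have "l \<in> permutations_of_set {0..<Suc k}" "last l = k" by simp_all
    then have l: "distinct l" "set l = {0..<Suc k}" "last l = k" using permutations_of_setD by simp_all
    then have "l \<noteq> []" by auto
    then obtain m where m: "l = m @ [k]" using l(3) append_butlast_last_id by metis
    have "set m = set l - {k}" "distinct m"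
      using l(1) m by auto
    moreover have "{0..<Suc k} - {k} = {0..<k}" by auto
    ultimately have dm: "distinct m" "set m = {0..<k}"
      unfolding l(2) by simp_all
    then show "butlast l @ [k] = l" "butlast l \<in> permutations_of_set {0..<k}"
      using m by (simp_all add: permutations_of_setI)
    \<comment> \<open>Being the largest letter and the last, \<open>k\<close> adds no inversion to
      either sign.\<close>
    have g: "(gsign S {k} :: 'a) = 1" if "S \<subseteq> {0..<k}" for S
    proof -
      have "{(s, t). s \<in> S \<and> t \<in> {k} \<and> t < s} = {}" using that by auto
      then show ?thesis by (simp only: gsign_def card.empty power_0)
    qed
    have sgn: "lsign (s @ [k]) = (lsign s :: 'a)" if "set s \<subseteq> {0..<k}" "distinct s" for s
    proof -
      have "distinct (s @ [k])" using that by auto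
      then show ?thesis by (simp only: lsign_append) (simp add: g[OF that(1)])
    qed
    have km: "t \<noteq> k" if "t \<in> set m" for t using that dm(2) by simp
    have f: "filter (\<lambda>t. t \<in> Q') m = filter (\<lambda>t. t \<in> Q) m"
      by (rule filter_cong) (simp_all add: Q'_def km)
    have "lsign (filter (\<lambda>t. t \<in> Q) m @ [k]) = (lsign (filter (\<lambda>t. t \<in> Q) m) :: 'a)"
      by (rule sgn) (simp_all add: dm subset_iff)
    moreover have "filter (\<lambda>t. t \<in> Q') l = filter (\<lambda>t. t \<in> Q) m @ (if card Q = 3 then [] else [k])"
      unfolding m filter_append f using kQ by (simp add: Q'_def)
    ultimately have "lsign (filter (\<lambda>t. t \<in> Q') l) = (lsign (filter (\<lambda>t. t \<in> Q) m) :: 'a)"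
      by (simp only: append_Nil2 simp_thms split: if_split)
    moreover have "lsign l = (lsign m :: 'a)"
      unfolding m by (rule sgn) (simp_all add: dm)
    moreover have "mtr n (mword n b l) = mword n a m i j"
    proof -
      have "mtr n (mword n b l) = mtr n (mmul n (mword n a m) (mmul n (b k) mid))"
        using b[of m] dm by (simp add: m mtr_mword_append)
      also have "\<dots> = mtr n (mmul n (mword n a m) (b k))"
        by (simp only: mmul_assoc[symmetric] mmul_mid_inner)
      also have "\<dots> = (\<Sum>r<n. if r = i then mword n a m i j else 0)"
        unfolding mtr_def mmul_def
      proof (intro sum.cong refl)
        fix r assume "r \<in> {..<n}"
        have "(\<Sum>c<n. mword n a m r c * b k c r) = (\<Sum>c<n. if c = j then (if r = i then mword n a m i j else 0) else 0)"
          by (intro sum.cong refl) (auto simp: b_def)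
        then show "(\<Sum>c<n. mword n a m r c * b k c r) = (if r = i then mword n a m i j else 0)"
          using ij by simp
      qed
      also have "\<dots> = mword n a m i j" using ij by simp
      finally show ?thesis .
    qed
    ultimately show "lsign (butlast l) * lsign (filter (\<lambda>t. t \<in> Q) (butlast l)) * mword n a (butlast l) i j = cyc_term n b Q' l"
      using m by (simp add: cyc_term_def)
  next
    fix l assume "l \<in> permutations_of_set {0..<k}"
    note l = permutations_of_setD[OF this]
    show "butlast (l @ [k]) = l" by simp
    have "set (l @ [k]) = {0..<Suc k}" by (simp add: l(1) atLeast0_lessThan_Suc)
    moreover have "distinct (l @ [k])" by (simp add: l)
    ultimately have "l @ [k] \<in> permutations_of_set {0..<Suc k}" by (rule permutations_of_setI)
    then show "l @ [k] \<in> {l \<in> permutations_of_set {0..<Suc k}. last l = k}" by simp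
  qed
  finally show ?thesis .
qed

theorem std_sum_homogeneous_eq_0:
  fixes a :: "nat \<Rightarrow> nat \<Rightarrow> nat \<Rightarrow> 'a::{idom,ring_char_0}"
  assumes n: "n \<ge> 2" and k: "k = 4 * n - 2" and ij: "i < n" "j < n"
    and U: "\<And>t. t < k \<Longrightarrow> U t \<subseteq> {0..<3}"
  shows "(\<Sum>l\<in>permutations_of_set {0..<k}. lsign l *
      gmat_prod n (map (\<lambda>t i j S. a t i j * gbasis (U t) S) l) i j S) = 0"
proof -
  define g where "g l = (gprod (map (\<lambda>t. gbasis (U t)) l) S :: 'a)" for l
  define Q where "Q = {t. t < k \<and> odd (card (U t))}"
  have Q: "Q \<subseteq> {0..<k}" "finite Q" by (auto simp: Q_def)
  have fin: "finite (U t)" if "t < k" for t using U[OF that] finite_subset by blast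
  show ?thesis
  proof (cases "card Q \<le> 3")
    case True
    \<comment> \<open>A swap of neighbours changes the sign of the Grassmann product exactly when
      both are odd, and likewise that of the filtered word; so \<open>h\<close> is constant on
      orderings.\<close>
    define h where "h l = g l * lsign (filter (\<lambda>t. t \<in> Q) l)" for l
    have swap: "h (xs @ y # x # ys) = h (xs @ x # y # ys)" if "xs @ x # y # ys \<in> permutations_of_set {0..<k}" for xs x y ys
    proof -
      note l = permutations_of_setD[OF that]
      have "x \<in> {0..<k}" "y \<in> {0..<k}" unfolding l(1)[symmetric] by simp_all
      then have xy: "x < k" "y < k" by simp_all
      have g: "g (xs @ y # x # ys) = (-1) ^ (card (U x) * card (U y)) * g (xs @ x # y # ys)"
        unfolding g_def by (rule fun_cong[OF gprod_swap]) (intro fin xy)+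
      show ?thesis
      proof (cases "x \<in> Q \<and> y \<in> Q")
        case True
        have "distinct (filter (\<lambda>t. t \<in> Q) (xs @ x # y # ys))"
          using l(2) by (rule distinct_filter)
        then have "lsign (filter (\<lambda>t. t \<in> Q) (xs @ y # x # ys)) = - (lsign (filter (\<lambda>t. t \<in> Q) (xs @ x # y # ys)) :: 'a)"
          using True lsign_swap[of "filter (\<lambda>t. t \<in> Q) xs" x y "filter (\<lambda>t. t \<in> Q) ys", where 'a = 'a] by simp
        moreover have "odd (card (U x) * card (U y))" using True by (simp add: Q_def)
        ultimately show ?thesis by (simp only: h_def g neg_one_odd_power) simp
      next
        case False
        then have "filter (\<lambda>t. t \<in> Q) (xs @ y # x # ys) = filter (\<lambda>t. t \<in> Q) (xs @ x # y # ys)" by auto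
        moreover have "even (card (U x) * card (U y))" using False xy by (auto simp: Q_def)
        ultimately show ?thesis by (simp only: h_def g neg_one_even_power mult_1_left)
      qed
    qed
    define c where "c = h [0..<k]"
    have gc: "g l = c * lsign (filter (\<lambda>t. t \<in> Q) l)" if l: "l \<in> permutations_of_set {0..<k}" for l
    proof -
      have "h l = c"
        unfolding c_def
      proof (rule permutations_of_set_swap_invariant[where h = h and A = "{0..<k}"])
        show "[0..<k] \<in> permutations_of_set {0..<k}" by (rule permutations_of_setI) simp_all
      qed (rule swap, assumption, rule l)
      then have "c * lsign (filter (\<lambda>t. t \<in> Q) l) = g l * (lsign (filter (\<lambda>t. t \<in> Q) l) * lsign (filter (\<lambda>t. t \<in> Q) l))"
        by (simp add: h_def mult.assoc)
      then show ?thesis by (simp add: lsign_square)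
    qed
    have "(\<Sum>l\<in>permutations_of_set {0..<k}. lsign l * gmat_prod n (map (\<lambda>t i j S. a t i j * gbasis (U t) S) l) i j S)
      = (\<Sum>l\<in>permutations_of_set {0..<k}. c * (lsign l * lsign (filter (\<lambda>t. t \<in> Q) l) * mword n a l i j))"
      unfolding gmat_prod_scaled g_def[symmetric] by (intro sum.cong refl) (simp add: gc)
    also have "\<dots> = c * (\<Sum>l\<in>permutations_of_set {0..<k}. lsign l * lsign (filter (\<lambda>t. t \<in> Q) l) * mword n a l i j)"
      by (simp only: sum_distrib_left)
    also have "\<dots> = 0"
      by (simp only: twisted_standard_sum_eq_0[OF n k Q(1) True ij] mult_zero_right)
    finally show ?thesis .
  next
    case False
    \<comment> \<open>More than three odd arguments have total degree above 3, and three generators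
      admit no such monomial.\<close>
    have "g l = 0" if "l \<in> permutations_of_set {0..<k}" for l
    proof (rule ccontr)
      assume "g l \<noteq> 0"
      then have S: "S = (\<Union>t\<in>set l. U t)" "card S = (\<Sum>t\<leftarrow>l. card (U t))"
        using gprod_gbasis_nonzero[of U l S, where 'a = 'a] unfolding g_def by blast+
      note l = permutations_of_setD[OF that]
      have "S \<subseteq> {0..<3}" unfolding S(1) l(1) by (rule UN_least) (simp add: U)
      then have "card S \<le> 3" using card_mono[of "{0..<3::nat}" S] by simp
      moreover have "card S = (\<Sum>t\<in>{0..<k}. card (U t))"
        unfolding S(2) by (simp only: sum_list_distinct_conv_sum_set[OF l(2)] l(1))
      moreover have "card Q \<le> (\<Sum>t\<in>{0..<k}. card (U t))"
      proof -
        have "card Q = (\<Sum>t\<in>Q. 1)" by simp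
        also have "\<dots> \<le> (\<Sum>t\<in>Q. card (U t))"
          by (rule sum_mono) (auto simp: Q_def intro: Suc_leI odd_pos)
        also have "\<dots> \<le> (\<Sum>t\<in>{0..<k}. card (U t))"
          by (rule sum_mono2) (use Q in auto)
        finally show ?thesis .
      qed
      ultimately show False using False by linarith
    qed
    then show ?thesis
      unfolding gmat_prod_scaled g_def[symmetric] by simp
  qed
qed

section \<open>Multilinear expansion\<close>

definition ebasis :: "nat \<times> nat \<times> nat set \<Rightarrow> 'a::comm_ring_1 gmat" where
  "ebasis = (\<lambda>(r, c, U) i j S. (if i = r \<and> j = c then 1 else 0) * gbasis U S)"

lemma of_int_gmat_prod:
  "gmat_prod n (map (\<lambda>t i j S. of_int (y t i j S)) l) i j S = (of_int (gmat_prod n (map y l) i j S) :: 'a::comm_ring_1)"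
proof (induction l arbitrary: i j S)
  case Nil
  then show ?case by (simp add: gmat_one_def gone_def)
next
  case (Cons t l)
  have IH: "gmat_prod n (map (\<lambda>t i j S. of_int (y t i j S)) l) i j = (\<lambda>S. of_int (gmat_prod n (map y l) i j S) :: 'a)" for i j
    by (rule ext) (rule Cons)
  show ?case by (simp add: gmat_mult_def IH gmult_def gsign_def)
qed

lemma of_int_lsign: "of_int (lsign l) = lsign l"
  by (induction l) (simp_all add: gsign_def)

lemma std_poly_of_int:
  "std_poly n k (\<lambda>t i j S. of_int (y t i j S)) i j S = of_int (std_poly n k y i j S)"
  by (simp only: std_poly_eq_sum_lists of_int_gmat_prod of_int_sum of_int_mult of_int_lsign)

text \<open>Basis arguments have integer entries, so the identity over \<open>int\<close> is carried
  by \<open>of_int\<close> to every commutative ring, where zero divisors and torsion may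
  occur.\<close>

lemma std_poly_ebasis_eq_0:
  assumes "n \<ge> 2" "i < n" "j < n" and b: "\<And>t. t < 4 * n - 2 \<Longrightarrow> snd (snd (b t)) \<subseteq> {0..<3}"
  shows "std_poly n (4 * n - 2) (\<lambda>t. ebasis (b t) :: 'a::comm_ring_1 gmat) i j S = 0"
proof -
  have eb: "std_poly n (4 * n - 2) (\<lambda>t. ebasis (b t)) i j S
      = (of_int (std_poly n (4 * n - 2) (\<lambda>t. ebasis (b t)) i j S) :: 'a)"
  proof -
    have "(\<lambda>t. ebasis (b t) :: 'a gmat) = (\<lambda>t i j S. of_int (ebasis (b t) i j S))"
      by (intro ext) (simp add: ebasis_def gbasis_def case_prod_beta)
    then show ?thesis by (simp only: std_poly_of_int)
  qed
  have "std_poly n (4 * n - 2) (\<lambda>t. ebasis (b t)) i j S = (0::int)"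
    unfolding std_poly_eq_sum_lists ebasis_def case_prod_beta
    by (rule std_sum_homogeneous_eq_0) (use assms in auto)
  then show ?thesis
    by (simp only: eb of_int_0)
qed

lemma gmat_prod_cong:
  assumes "\<And>t i j. t \<in> set l \<Longrightarrow> i < n \<Longrightarrow> j < n \<Longrightarrow> x t i j = y t i j" "i < n" "j < n"
  shows "gmat_prod n (map x l) i j = gmat_prod n (map y l) i j"
  using assms
  by (induction l arbitrary: i j) (auto simp: gmat_mult_def intro!: ext sum.cong)

lemma gmat_prod_linear:
  assumes "distinct l" "t \<in> set l"
  shows "gmat_prod n (map (x(t := (\<lambda>i j S. \<Sum>b\<in>B. c b * e b i j S))) l) i j S
    = (\<Sum>b\<in>B. c b * gmat_prod n (map (x(t := e b)) l) i j S)"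
  using assms
proof (induction l arbitrary: i j S)
  case (Cons s l)
  show ?case
  proof (cases "s = t")
    case True
    then have "t \<notin> set l" using Cons by auto
    then have m: "map (x(t := z)) l = map x l" for z by auto
    have "gmat_prod n (map (x(t := (\<lambda>i j S. \<Sum>b\<in>B. c b * e b i j S))) (s # l)) i j S
       = (\<Sum>m<n. \<Sum>b\<in>B. c b * gmult (e b i m) (gmat_prod n (map x l) m j) S)"
      using True by (simp add: m gmat_mult_def gmult_sum_left gmult_scale_left)
    also have "\<dots> = (\<Sum>b\<in>B. \<Sum>m<n. c b * gmult (e b i m) (gmat_prod n (map x l) m j) S)"
      by (rule sum.swap)
    also have "\<dots> = (\<Sum>b\<in>B. c b * gmat_prod n (map (x(t := e b)) (s # l)) i j S)"
      using True by (simp add: m gmat_mult_def sum_distrib_left)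
    finally show ?thesis .
  next
    case False
    then have "t \<in> set l" "distinct l" using Cons by auto
    then have IH: "gmat_prod n (map (x(t := (\<lambda>i j S. \<Sum>b\<in>B. c b * e b i j S))) l) i j
      = (\<lambda>S. \<Sum>b\<in>B. c b * gmat_prod n (map (x(t := e b)) l) i j S)" for i j
      by (intro ext Cons.IH)
    have "gmat_prod n (map (x(t := (\<lambda>i j S. \<Sum>b\<in>B. c b * e b i j S))) (s # l)) i j S
       = (\<Sum>m<n. \<Sum>b\<in>B. c b * gmult (x s i m) (gmat_prod n (map (x(t := e b)) l) m j) S)"
      using False by (simp add: IH gmat_mult_def gmult_sum_right gmult_scale_right)
    also have "\<dots> = (\<Sum>b\<in>B. \<Sum>m<n. c b * gmult (x s i m) (gmat_prod n (map (x(t := e b)) l) m j) S)"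
      by (rule sum.swap)
    also have "\<dots> = (\<Sum>b\<in>B. c b * gmat_prod n (map (x(t := e b)) (s # l)) i j S)"
      using False by (simp add: gmat_mult_def sum_distrib_left)
    finally show ?thesis .
  qed
qed simp

lemma std_poly_linear:
  assumes "t < k"
  shows "std_poly n k (x(t := (\<lambda>i j S. \<Sum>b\<in>B. c b * e b i j S))) i j S
    = (\<Sum>b\<in>B. c b * std_poly n k (x(t := e b)) i j S)"
proof -
  have "std_poly n k (x(t := (\<lambda>i j S. \<Sum>b\<in>B. c b * e b i j S))) i j S
     = (\<Sum>l\<in>permutations_of_set {0..<k}. \<Sum>b\<in>B. c b * (lsign l * gmat_prod n (map (x(t := e b)) l) i j S))"
    unfolding std_poly_eq_sum_lists
  proof (intro sum.cong refl)
    fix l assume "l \<in> permutations_of_set {0..<k}"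
    note l = permutations_of_setD[OF this]
    then have "distinct l" "t \<in> set l" using assms by simp_all
    then show "lsign l * gmat_prod n (map (x(t := (\<lambda>i j S. \<Sum>b\<in>B. c b * e b i j S))) l) i j S
       = (\<Sum>b\<in>B. c b * (lsign l * gmat_prod n (map (x(t := e b)) l) i j S))"
      by (simp only: gmat_prod_linear sum_distrib_left mult.left_commute)
  qed
  also have "\<dots> = (\<Sum>b\<in>B. \<Sum>l\<in>permutations_of_set {0..<k}. c b * (lsign l * gmat_prod n (map (x(t := e b)) l) i j S))"
    by (rule sum.swap)
  finally show ?thesis
    unfolding std_poly_eq_sum_lists by (simp only: sum_distrib_left)
qed

lemma ebasis_expansion:
  assumes x: "\<And>i j. i < n \<Longrightarrow> j < n \<Longrightarrow> x i j \<in> grass_carrier 3" and ij: "i < n" "j < n"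
  shows "x i j S = (\<Sum>b\<in>{..<n} \<times> {..<n} \<times> Pow {0..<3}. (case b of (r, c, U) \<Rightarrow> x r c U) * ebasis b i j S)"
proof -
  have "(\<Sum>b\<in>{..<n} \<times> {..<n} \<times> Pow {0..<3}. (case b of (r, c, U) \<Rightarrow> x r c U) * ebasis b i j S)
     = (\<Sum>b\<in>{..<n} \<times> {..<n} \<times> Pow {0..<3}. if b = (i, j, S) then x i j S else 0)"
    by (intro sum.cong refl) (auto simp: ebasis_def gbasis_def split: if_splits)
  also have "\<dots> = (if S \<subseteq> {0..<3} then x i j S else 0)"
    using ij by simp
  also have "\<dots> = x i j S"
    using x[OF ij] by (simp add: grass_carrier_def)
  finally show ?thesis ..
qed

text \<open>Arguments are expanded one at a time: induction on the number \<open>m\<close> of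
  leading arguments that are arbitrary while the others are basis elements.\<close>

lemma std_poly_eq_0:
  fixes x :: "nat \<Rightarrow> 'a::comm_ring_1 gmat"
  assumes n: "n \<ge> 2" and k: "k = 4 * n - 2" and ij: "i < n" "j < n"
    and x: "\<And>t i j. t < k \<Longrightarrow> i < n \<Longrightarrow> j < n \<Longrightarrow> x t i j \<in> grass_carrier 3"
  shows "std_poly n k x i j S = 0"
proof -
  let ?B = "{..<n} \<times> {..<n} \<times> Pow {0..<3} :: (nat \<times> nat \<times> nat set) set"
  have "std_poly n k (\<lambda>t. if t < m then x t else ebasis (b t)) i j S = 0"
    if "m \<le> k" "\<And>t. t < k \<Longrightarrow> b t \<in> ?B" for m b
    using that
  proof (induction m arbitrary: b)
    case 0
    then have "snd (snd (b t)) \<subseteq> {0..<3}" if "t < 4 * n - 2" for t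
      using that k by fastforce
    then show ?case using std_poly_ebasis_eq_0[OF n ij, of b S, where 'a = 'a] k by simp
  next
    case (Suc m)
    let ?y = "\<lambda>t. if t < m then x t else ebasis (b t)"
    let ?c = "\<lambda>(r, c, U). x m r c U"
    have "std_poly n k (\<lambda>t. if t < Suc m then x t else ebasis (b t)) i j S
       = std_poly n k (?y(m := (\<lambda>i j S. \<Sum>e\<in>?B. ?c e * ebasis e i j S))) i j S"
      unfolding std_poly_eq_sum_lists
    proof (intro sum.cong refl arg_cong2[of _ _ _ _ "(*)"] fun_cong[OF gmat_prod_cong] ij)
      fix l t i j assume "i < n" "j < n"
      have "x m i j = (\<lambda>S. \<Sum>e\<in>?B. ?c e * ebasis e i j S)"
        using Suc.prems x \<open>i < n\<close> \<open>j < n\<close> by (intro ext ebasis_expansion[of n "x m"]) auto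
      then show "(if t < Suc m then x t else ebasis (b t)) i j
          = (?y(m := (\<lambda>i j S. \<Sum>e\<in>?B. ?c e * ebasis e i j S))) t i j"
        by (auto simp: less_Suc_eq)
    qed
    also have "\<dots> = (\<Sum>e\<in>?B. ?c e * std_poly n k (?y(m := ebasis e)) i j S)"
      by (rule std_poly_linear) (use Suc.prems in simp)
    also have "\<dots> = 0"
    proof (intro sum.neutral ballI)
      fix e assume e: "e \<in> ?B"
      have "?y(m := ebasis e) = (\<lambda>t. if t < m then x t else ebasis ((b(m := e)) t))" by auto
      then show "?c e * std_poly n k (?y(m := ebasis e)) i j S = 0"
        using Suc.IH[of "b(m := e)"] Suc.prems e by auto
    qed
    finally show ?case .
  qed
  \<comment> \<open>The triple is a filler for positions from \<open>k\<close> on, which no ordering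
    of \<open>{0..<k}\<close> reads; it lies in \<open>?B\<close> since n is positive.\<close>
  from this[of k "\<lambda>_. (0, 0, {})"]
  have "std_poly n k (\<lambda>t. if t < k then x t else ebasis (0, 0, {})) i j S = 0"
    using n by simp
  also have "std_poly n k (\<lambda>t. if t < k then x t else ebasis (0, 0, {})) i j S = std_poly n k x i j S"
    unfolding std_poly_eq_sum_lists
  proof (intro sum.cong refl arg_cong2[of _ _ _ _ "(*)"] fun_cong[OF gmat_prod_cong] ij)
    fix l t i j assume "l \<in> permutations_of_set {0..<k}" "t \<in> set l"
    then have "t < k" using permutations_of_setD(1)[of l "{0..<k}"] by simp
    then show "(if t < k then x t else ebasis (0, 0, {})) i j = x t i j" by simp
  qed
  finally show ?thesis .
qed

theorem theorem1p2:
  fixes n :: nat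
  assumes "n \<ge> 2"
  shows "std_identity_of TYPE('a::comm_ring_1) n 2 (4 * n - 2) \<and>
         std_identity_of TYPE('a::comm_ring_1) n 3 (4 * n - 2)"
proof -
  have "std_identity_of TYPE('a) n m (4 * n - 2)" if "m \<le> 3" for m
    unfolding std_identity_of_def
  proof (intro allI impI)
    fix x :: "nat \<Rightarrow> 'a gmat" and i j S
    assume x: "\<forall>t<4 * n - 2. \<forall>i<n. \<forall>j<n. x t i j \<in> grass_carrier m" and ij: "i < n" "j < n"
    \<comment> \<open>Fewer generators span a subset of E^3, so both cases follow from the one for
      three generators.\<close>
    have "grass_carrier m \<subseteq> (grass_carrier 3 :: 'a grass set)"
    proof
      fix y :: "'a grass"
      assume y: "y \<in> grass_carrier m"
      have m: "{0..<m} \<subseteq> {0..<3}" using that by auto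
      have "y S = 0" if "\<not> S \<subseteq> {0..<3}" for S
      proof -
        have "\<not> S \<subseteq> {0..<m}" using that order_trans[OF _ m] by fast
        then show ?thesis using y by (simp add: grass_carrier_def)
      qed
      then show "y \<in> grass_carrier 3" by (simp add: grass_carrier_def)
    qed
    then have "x t i j \<in> grass_carrier 3" if "t < 4 * n - 2" "i < n" "j < n" for t i j
      using x that by (metis subsetD)
    then show "std_poly n (4 * n - 2) x i j S = 0"
      by (rule std_poly_eq_0[OF assms refl ij])
  qed
  then show ?thesis by simp
qed

end
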